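(* Let $s\in\mathbb Z$. If $f$ is a square integrable bi-$s$-associated function on $SO(3)$, then the random field $X^f$ on $SO(3)$ defined by $X^f_g=S(L_gf)$ is a second order, square integrable, Gaussian, isotropic random field of type $s$. Moreover it is complex Gaussian.
   Context: Let $K\cong SO(2)$ be the subgroup of $SO(3)$ fixing the north pole of $\mathbb S^2$ and, for $s\in\mathbb Z$, let $\chi_s(k)=e^{is\vartheta(k)}$ be the $s$-th character of $K$ ($\vartheta(k)$ the rotation angle). A function $f\in L^2(SO(3))$ is bi-$s$-associated if $f(k_1gk_2)=\chi_s(k_1)f(g)\chi_s(k_2)$ for all $g\in SO(3)$, $k_1,k_2\in K$. White noise: with $(e_n)$ an orthonormal basis of $L^2(SO(3))$ (normalized Haar measure) consisting of real functions and $(X_n)$ i.i.d. standard real Gaussian variables, $S(\sum_k\alpha_ke_k)=\sum_k\alpha_kX_k$ for complex $\alpha_k$; $L_gf(h)=f(g^{-1}h)$; a jointly measurable version of $X^f$ is understood. A random field $X$ on $SO(3)$ is second order if $\mathbb E|X_g|^2<\infty$ for all $g$; square integrable if $\int_{SO(3)}|X_g|^2dg<\infty$ a.s.; of type $s$ if $X_{gk}=\chi_s(k^{-1})X_g$ (a.s.) for all $g\in SO(3),k\in K$; isotropic if, writing $X(h)=\int X_g\overline{h(g)}dg$, the vectors $(X(h_1),\dots,X(h_m))$ and $(X(L_gh_1),\dots,X(L_gh_m))$ have the same law for all $g$, $m$ and $h_i\in L^2(SO(3))$; complex Gaussian if for every $\psi\in L^2(SO(3))$ the variable $\int X_g\psi(g)dg$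 has independent Gaussian real and imaginary parts with the same variance.
   Formalization: "Moreover it is complex Gaussian" is claimed only for s ≠ 0; at s = 0 it fails (f = 1 gives a real field, so with ψ = 1 the variances of the real and imaginary parts are 1 and 0), and holds there only for f = 0. *)

theory Defs
  imports "HOL-Probability.Probability"
begin

section \<open>The rotation group, its Haar measure, and the characters of the isotropy group\<close>

type_synonym mat3 = "real^3^3"

definition SO3 :: "mat3 set" where
  "SO3 = {A. rotation_matrix A}"

definition north_pole :: "real^3" where
  "north_pole = axis 3 1"

definition K_north :: "mat3 set" where
  "K_north = {k \<in> SO3. k *v north_pole = north_pole}"

definition zrot :: "real \<Rightarrow> mat3" where
  "zrot t = vector [vector [cos t, - sin t, 0],
                    vector [sin t,   cos t, 0],
                    vector [    0,       0, 1]]"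

text \<open>The representative of the angle is irrelevant in \<open>chi\<close>, since \<open>s\<close> is an integer.\<close>

definition rot_angle :: "mat3 \<Rightarrow> real" where
  "rot_angle k = (THE t. 0 \<le> t \<and> t < 2 * pi \<and> k = zrot t)"

definition chi :: "int \<Rightarrow> mat3 \<Rightarrow> complex" where
  "chi s k = exp (\<i> * of_int s * of_real (rot_angle k))"

text \<open>By uniqueness of Haar measure, at most one \<open>\<mu>\<close> satisfies this predicate.\<close>

definition normalized_haar :: "mat3 measure \<Rightarrow> bool" where
  "normalized_haar \<mu> \<longleftrightarrow>
     prob_space \<mu> \<and> sets \<mu> = sets (restrict_space borel SO3) \<and>
     (\<forall>g\<in>SO3. distr \<mu> \<mu> (\<lambda>h. g ** h) = \<mu>)"

definition translate :: "mat3 \<Rightarrow> (mat3 \<Rightarrow> complex) \<Rightarrow> mat3 \<Rightarrow> complex" where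
  "translate g f = (\<lambda>h. f (matrix_inv g ** h))"

definition in_L2 :: "'a measure \<Rightarrow> ('a \<Rightarrow> complex) \<Rightarrow> bool" where
  "in_L2 N \<phi> \<longleftrightarrow> \<phi> \<in> borel_measurable N \<and> integrable N (\<lambda>x. (cmod (\<phi> x))\<^sup>2)"

definition bi_associated :: "int \<Rightarrow> (mat3 \<Rightarrow> complex) \<Rightarrow> bool" where
  "bi_associated s f \<longleftrightarrow>
     (\<forall>g\<in>SO3. \<forall>k1\<in>K_north. \<forall>k2\<in>K_north. f (k1 ** g ** k2) = chi s k1 * f g * chi s k2)"

section \<open>White noise\<close>

text \<open>An orthonormal basis of the complex space \<open>L\<^sup>2\<close> whose elements are real functions:
  orthonormal, with dense complex linear span.\<close>

definition real_orthonormal_basis :: "mat3 measure \<Rightarrow> (nat \<Rightarrow> mat3 \<Rightarrow> real) \<Rightarrow> bool" where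
  "real_orthonormal_basis \<mu> e \<longleftrightarrow>
     (\<forall>n. in_L2 \<mu> (\<lambda>h. complex_of_real (e n h))) \<and>
     (\<forall>m n. (\<integral>h. e m h * e n h \<partial>\<mu>) = (if m = n then 1 else 0)) \<and>
     (\<forall>\<phi> \<epsilon>. in_L2 \<mu> \<phi> \<and> \<epsilon> > 0 \<longrightarrow>
        (\<exists>n (c :: nat \<Rightarrow> complex).
           (\<integral>h. (cmod (\<phi> h - (\<Sum>k<n. c k * of_real (e k h))))\<^sup>2 \<partial>\<mu>) < \<epsilon>))"

definition iid_std_normal :: "'w measure \<Rightarrow> (nat \<Rightarrow> 'w \<Rightarrow> real) \<Rightarrow> bool" where
  "iid_std_normal M \<xi> \<longleftrightarrow>
     prob_space.indep_vars M (\<lambda>_. borel) \<xi> UNIV \<and>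
     (\<forall>n. distr M borel (\<xi> n) = std_normal_distribution)"

definition fourier_coeff ::
    "mat3 measure \<Rightarrow> (nat \<Rightarrow> mat3 \<Rightarrow> real) \<Rightarrow> (mat3 \<Rightarrow> complex) \<Rightarrow> nat \<Rightarrow> complex" where
  "fourier_coeff \<mu> e \<phi> k = (\<integral>h. \<phi> h * of_real (e k h) \<partial>\<mu>)"

text \<open>The value of \<open>white_noise\<close> at \<open>\<phi> = \<Sum>\<^sub>k \<alpha>\<^sub>k e\<^sub>k\<close> is the sum \<open>\<Sum>\<^sub>k \<alpha>\<^sub>k \<xi>\<^sub>k\<close>, understood as an \<open>L\<^sup>2(M)\<close> limit.
  That limit is only determined almost surely; an arbitrary representative is chosen.\<close>

definition white_noise ::
    "mat3 measure \<Rightarrow> 'w measure \<Rightarrow> (nat \<Rightarrow> mat3 \<Rightarrow> real) \<Rightarrow> (nat \<Rightarrow> 'w \<Rightarrow> real) \<Rightarrow>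
     (mat3 \<Rightarrow> complex) \<Rightarrow> 'w \<Rightarrow> complex" where
  "white_noise \<mu> M e \<xi> \<phi> =
     (SOME Z. in_L2 M Z \<and>
        (\<lambda>n. \<integral>\<omega>. (cmod (Z \<omega> - (\<Sum>k<n. fourier_coeff \<mu> e \<phi> k * of_real (\<xi> k \<omega>))))\<^sup>2 \<partial>M)
          \<longlonglongrightarrow> 0)"

section \<open>Random fields on the rotation group\<close>

definition jointly_measurable_version ::
    "mat3 measure \<Rightarrow> 'w measure \<Rightarrow> (mat3 \<Rightarrow> 'w \<Rightarrow> complex) \<Rightarrow> (mat3 \<Rightarrow> 'w \<Rightarrow> complex) \<Rightarrow> bool"
  where
  "jointly_measurable_version \<mu> M X Y \<longleftrightarrow>
     (\<lambda>(g, \<omega>). X g \<omega>) \<in> borel_measurable (\<mu> \<Otimes>\<^sub>M M) \<and>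
     (\<forall>g\<in>SO3. AE \<omega> in M. X g \<omega> = Y g \<omega>)"

definition second_order :: "'w measure \<Rightarrow> (mat3 \<Rightarrow> 'w \<Rightarrow> complex) \<Rightarrow> bool" where
  "second_order M X \<longleftrightarrow> (\<forall>g\<in>SO3. in_L2 M (X g))"

definition square_integrable_field ::
    "mat3 measure \<Rightarrow> 'w measure \<Rightarrow> (mat3 \<Rightarrow> 'w \<Rightarrow> complex) \<Rightarrow> bool" where
  "square_integrable_field \<mu> M X \<longleftrightarrow> (AE \<omega> in M. in_L2 \<mu> (\<lambda>g. X g \<omega>))"

definition of_type :: "int \<Rightarrow> 'w measure \<Rightarrow> (mat3 \<Rightarrow> 'w \<Rightarrow> complex) \<Rightarrow> bool" where
  "of_type s M X \<longleftrightarrow>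
     (\<forall>g\<in>SO3. \<forall>k\<in>K_north. AE \<omega> in M. X (g ** k) \<omega> = chi s (matrix_inv k) * X g \<omega>)"

definition smeared ::
    "mat3 measure \<Rightarrow> (mat3 \<Rightarrow> 'w \<Rightarrow> complex) \<Rightarrow> (mat3 \<Rightarrow> complex) \<Rightarrow> 'w \<Rightarrow> complex" where
  "smeared \<mu> X h = (\<lambda>\<omega>. \<integral>g. X g \<omega> * cnj (h g) \<partial>\<mu>)"

definition isotropic ::
    "mat3 measure \<Rightarrow> 'w measure \<Rightarrow> (mat3 \<Rightarrow> 'w \<Rightarrow> complex) \<Rightarrow> bool" where
  "isotropic \<mu> M X \<longleftrightarrow>
     (\<forall>g\<in>SO3. \<forall>m. \<forall>h :: nat \<Rightarrow> mat3 \<Rightarrow> complex. (\<forall>i<m. in_L2 \<mu> (h i)) \<longrightarrow>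
        distr M (Pi\<^sub>M {..<m} (\<lambda>_. borel)) (\<lambda>\<omega>. \<lambda>i\<in>{..<m}. smeared \<mu> X (h i) \<omega>) =
        distr M (Pi\<^sub>M {..<m} (\<lambda>_. borel)) (\<lambda>\<omega>. \<lambda>i\<in>{..<m}. smeared \<mu> X (translate g (h i)) \<omega>))"

text \<open>Point masses count as (degenerate) Gaussian laws.\<close>

definition gaussian_rv :: "'w measure \<Rightarrow> ('w \<Rightarrow> real) \<Rightarrow> bool" where
  "gaussian_rv M Y \<longleftrightarrow> Y \<in> borel_measurable M \<and>
     (\<exists>m. distr M borel Y = return borel m \<or>
          (\<exists>\<sigma>>0. distr M borel Y = density lborel (normal_density m \<sigma>)))"

text \<open>All finite-dimensional marginals \<open>(Re X\<^bsub>g\<^sub>0\<^esub>, Im X\<^bsub>g\<^sub>0\<^esub>, Re X\<^bsub>g\<^sub>1\<^esub>, \<dots>)\<close> are Gaussian vectors.\<close>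

definition gaussian_field :: "'w measure \<Rightarrow> (mat3 \<Rightarrow> 'w \<Rightarrow> complex) \<Rightarrow> bool" where
  "gaussian_field M X \<longleftrightarrow>
     (\<forall>m. \<forall>g :: nat \<Rightarrow> mat3. \<forall>a b :: nat \<Rightarrow> real. (\<forall>i<m. g i \<in> SO3) \<longrightarrow>
        gaussian_rv M (\<lambda>\<omega>. \<Sum>i<m. a i * Re (X (g i) \<omega>) + b i * Im (X (g i) \<omega>)))"

text \<open>The integral here is bilinear in \<open>X\<close> and \<open>\<psi>\<close>, without the conjugation in \<open>smeared\<close>.
  A field of type \<open>0\<close> need not have this property: for \<open>f = 1\<close> the field is constant in \<open>g\<close> and real, so
  for \<open>\<psi> = 1\<close> the two variances are \<open>1\<close> and \<open>0\<close>.\<close>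

definition complex_gaussian_field ::
    "mat3 measure \<Rightarrow> 'w measure \<Rightarrow> (mat3 \<Rightarrow> 'w \<Rightarrow> complex) \<Rightarrow> bool" where
  "complex_gaussian_field \<mu> M X \<longleftrightarrow>
     (\<forall>\<psi>. in_L2 \<mu> \<psi> \<longrightarrow>
        (let Z = (\<lambda>\<omega>. \<integral>g. X g \<omega> * \<psi> g \<partial>\<mu>) in
           gaussian_rv M (\<lambda>\<omega>. Re (Z \<omega>)) \<and> gaussian_rv M (\<lambda>\<omega>. Im (Z \<omega>)) \<and>
           prob_space.indep_var M borel (\<lambda>\<omega>. Re (Z \<omega>)) borel (\<lambda>\<omega>. Im (Z \<omega>)) \<and>
           prob_space.variance M (\<lambda>\<omega>. Re (Z \<omega>)) = prob_space.variance M (\<lambda>\<omega>. Im (Z \<omega>))))"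

end

theory Submission
  imports Defs
begin

text \<open>A real part of a white noise variable is centred Gaussian, and by Parseval's identity its
  variance is the squared norm of the real part of the function it is evaluated at. Fubini's theorem
  gives \<open>\<integral> X\<^sub>g \<psi>(g) dg = S(\<phi>)\<close> with \<open>\<phi>(x) = \<integral> f(u\<^sup>-\<^sup>1x) \<psi>(u) du\<close>. Translating \<open>\<psi>\<close> translates \<open>\<phi>\<close>,
  so invariance of Haar measure preserves all these variances, which is isotropy. Right association of
  \<open>f\<close> gives \<open>\<phi>(xk) = \<phi>(x) \<chi>\<^sub>s(k)\<close>; for \<open>s \<noteq> 0\<close> a choice of \<open>k\<close> with \<open>\<chi>\<^sub>s(k)\<^sup>2 = -1\<close> forces
  \<open>\<integral> \<phi>\<^sup>2 = 0\<close>, that is, the real and imaginary parts are uncorrelated with equal variances.\<close>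

section \<open>Square integrable functions\<close>

text \<open>The white noise is an arbitrarily chosen representative of an L2 limit, so the relation
  \<open>noise_limit\<close> carries the argument: it survives linear combinations and almost sure
  modification, and it determines its limit almost surely. The smearing formula thus exchanges an
  integral not only with an integral but with an L2 limit taken separately for each g. This works
  because L_g f has the same norm for every g, which dominates the remainders of the series
  uniformly over the group. Laws are compared through characteristic functions. Parseval's identity
  applies to real parts because the basis is real: the real part of a coefficient is then a
  coefficient of the real part. Joint laws need uniqueness for random vectors, which is reduced to
  the one-dimensional theorem. Haar measure is given as left invariant; the right invariance behind
  the step with k comes from its uniqueness among invariant probability measures. That the field has
  type s comes from association of f on the left.\<close>

lemma in_L2_measurable: "in_L2 N f \<Longrightarrow> f \<in> borel_measurable N"
  by (simp add: in_L2_def)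

lemma in_L2_integrable_power2: "in_L2 N f \<Longrightarrow> integrable N (\<lambda>x. (cmod (f x))\<^sup>2)"
  by (simp add: in_L2_def)

lemma cmod_add_power2_le: "(cmod (a + b))\<^sup>2 \<le> 2 * (cmod a)\<^sup>2 + 2 * (cmod b)\<^sup>2"
proof -
  have "(cmod (a + b))\<^sup>2 \<le> (cmod a + cmod b)\<^sup>2"
    by (intro power_mono norm_triangle_ineq norm_ge_zero)
  also have "\<dots> \<le> 2 * (cmod a)\<^sup>2 + 2 * (cmod b)\<^sup>2"
    using sum_squares_bound[of "cmod a" "cmod b"] by (simp add: power2_sum)
  finally show ?thesis .
qed

lemma in_L2_bounded_by:
  assumes "f \<in> borel_measurable N" "integrable N w" "AE x in N. (cmod (f x))\<^sup>2 \<le> w x"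
  shows "in_L2 N f"
  unfolding in_L2_def
proof (intro conjI assms(1) Bochner_Integration.integrable_bound[OF assms(2)])
  show "AE x in N. norm ((cmod (f x))\<^sup>2) \<le> norm (w x)"
    using assms(3) by eventually_elim auto
qed (use assms(1) in measurable)

lemma in_L2_cong_AE:
  assumes "in_L2 N f" "g \<in> borel_measurable N" "AE x in N. g x = f x"
  shows "in_L2 N g"
  by (rule in_L2_bounded_by[OF assms(2) in_L2_integrable_power2[OF assms(1)]]) (use assms(3) in auto)

lemma in_L2_cmult: "in_L2 N f \<Longrightarrow> in_L2 N (\<lambda>x. c * f x)"
  by (auto simp: in_L2_def norm_mult power_mult_distrib)

lemma in_L2_zero: "in_L2 N (\<lambda>_. 0)"
  by (simp add: in_L2_def)

lemma in_L2_add: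
  assumes "in_L2 N f" "in_L2 N g"
  shows "in_L2 N (\<lambda>x. f x + g x)"
proof (rule in_L2_bounded_by)
  show "(\<lambda>x. f x + g x) \<in> borel_measurable N"
    using assms[THEN in_L2_measurable] by measurable
  show "integrable N (\<lambda>x. 2 * (cmod (f x))\<^sup>2 + 2 * (cmod (g x))\<^sup>2)"
    using assms by (auto simp: in_L2_def)
qed (simp add: cmod_add_power2_le)

lemma in_L2_diff: "in_L2 N f \<Longrightarrow> in_L2 N g \<Longrightarrow> in_L2 N (\<lambda>x. f x - g x)"
  using in_L2_add[of N f "\<lambda>x. (-1) * g x"] in_L2_cmult[of N g "-1"] by simp

lemma in_L2_sum: "(\<And>i. i \<in> A \<Longrightarrow> in_L2 N (f i)) \<Longrightarrow> in_L2 N (\<lambda>x. \<Sum>i\<in>A. f i x)"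
  by (induction A rule: infinite_finite_induct) (auto intro: in_L2_add in_L2_zero)

lemma borel_measurable_cnj [measurable (raw)]:
  "f \<in> borel_measurable N \<Longrightarrow> (\<lambda>x. cnj (f x)) \<in> borel_measurable N"
  by (rule borel_measurable_continuous_on) (auto intro: continuous_intros)

lemma in_L2_cnj: "in_L2 N f \<Longrightarrow> in_L2 N (\<lambda>x. cnj (f x))"
  by (auto simp: in_L2_def)

lemma in_L2_of_real_Re:
  assumes "in_L2 N f"
  shows "in_L2 N (\<lambda>x. of_real (Re (f x)))"
proof (rule in_L2_bounded_by[OF _ in_L2_integrable_power2[OF assms]])
  show "(\<lambda>x. complex_of_real (Re (f x))) \<in> borel_measurable N"
    using in_L2_measurable[OF assms] by measurable
  show "AE x in N. (cmod (complex_of_real (Re (f x))))\<^sup>2 \<le> (cmod (f x))\<^sup>2"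
    by (intro AE_I2 power_mono) (simp_all add: abs_Re_le_cmod)
qed

lemma (in prob_space) in_L2_const: "in_L2 M (\<lambda>_. c)"
  by (simp add: in_L2_def)

section \<open>Cauchy-Schwarz inequality and completeness of L2\<close>

lemma in_L2_integrable_norm_mult:
  assumes "in_L2 N f" "in_L2 N g"
  shows "integrable N (\<lambda>x. cmod (f x) * cmod (g x))"
proof (rule Bochner_Integration.integrable_bound)
  show "integrable N (\<lambda>x. (cmod (f x))\<^sup>2 + (cmod (g x))\<^sup>2)"
    using assms by (auto simp: in_L2_def)
  show "(\<lambda>x. cmod (f x) * cmod (g x)) \<in> borel_measurable N"
    using assms[THEN in_L2_measurable] by measurable
  show "AE x in N. norm (cmod (f x) * cmod (g x)) \<le> norm ((cmod (f x))\<^sup>2 + (cmod (g x))\<^sup>2)"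
  proof (rule AE_I2)
    fix x
    have "2 * (cmod (f x) * cmod (g x)) \<le> (cmod (f x))\<^sup>2 + (cmod (g x))\<^sup>2"
      using sum_squares_bound[of "cmod (f x)" "cmod (g x)"] by simp
    moreover have "0 \<le> cmod (f x) * cmod (g x)" by simp
    ultimately show "norm (cmod (f x) * cmod (g x)) \<le> norm ((cmod (f x))\<^sup>2 + (cmod (g x))\<^sup>2)"
      unfolding real_norm_def by linarith
  qed
qed

lemma in_L2_integrable_mult:
  assumes "in_L2 N f" "in_L2 N g"
  shows "integrable N (\<lambda>x. f x * g x)"
  by (rule Bochner_Integration.integrable_bound[OF in_L2_integrable_norm_mult[OF assms]])
     (use assms in \<open>auto simp: in_L2_def norm_mult\<close>)

lemma (in prob_space) in_L2_integrable: "in_L2 M f \<Longrightarrow> integrable M f"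
  using in_L2_integrable_mult[OF _ in_L2_const[of 1], of f] by simp

text \<open>The integral of the square of |f| - t |g| is a nonnegative polynomial in t. Its value at
  the minimum t = C / B gives the inequality; for B = 0 the polynomial is affine, so its slope must
  vanish.\<close>

lemma L2_Cauchy_Schwarz_norm:
  assumes "in_L2 N f" "in_L2 N g"
  shows "(\<integral>x. cmod (f x) * cmod (g x) \<partial>N)\<^sup>2 \<le> (\<integral>x. (cmod (f x))\<^sup>2 \<partial>N) * (\<integral>x. (cmod (g x))\<^sup>2 \<partial>N)"
    (is "?C\<^sup>2 \<le> ?A * ?B")
proof -
  have q: "0 \<le> ?A - 2 * t * ?C + t\<^sup>2 * ?B" for t
  proof -
    have "0 \<le> (\<integral>x. (cmod (f x) - t * cmod (g x))\<^sup>2 \<partial>N)"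
      by simp
    also have "\<dots> = (\<integral>x. (cmod (f x))\<^sup>2 - 2 * t * (cmod (f x) * cmod (g x)) + t\<^sup>2 * (cmod (g x))\<^sup>2 \<partial>N)"
      by (intro Bochner_Integration.integral_cong) (auto simp: power2_eq_square algebra_simps)
    also have "\<dots> = ?A - 2 * t * ?C + t\<^sup>2 * ?B"
      using in_L2_integrable_norm_mult[OF assms] assms by (simp add: in_L2_def)
    finally show ?thesis .
  qed
  show ?thesis
  proof (cases "?B = 0")
    case True
    have "?C = 0"
    proof (rule ccontr)
      assume C: "?C \<noteq> 0"
      \<comment> \<open>At this t the affine polynomial A - 2 t C takes the value -1.\<close>
      show False
        using q[of "(?A + 1) / (2 * ?C)"] C True by (simp add: field_simps)
    qed
    then show ?thesis using True by simp
  next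
    case False
    moreover have "0 \<le> ?B" by simp
    ultimately have B: "0 < ?B" by linarith
    have "0 \<le> ?A - ?C\<^sup>2 / ?B"
      using q[of "?C / ?B"] B by (simp add: field_simps power2_eq_square)
    then show ?thesis using B by (simp add: field_simps)
  qed
qed

lemma L2_Cauchy_Schwarz:
  assumes "in_L2 N f" "in_L2 N g"
  shows "(cmod (\<integral>x. f x * g x \<partial>N))\<^sup>2 \<le> (\<integral>x. (cmod (f x))\<^sup>2 \<partial>N) * (\<integral>x. (cmod (g x))\<^sup>2 \<partial>N)"
proof -
  have "cmod (\<integral>x. f x * g x \<partial>N) \<le> (\<integral>x. cmod (f x) * cmod (g x) \<partial>N)"
    using integral_norm_bound[of N "\<lambda>x. f x * g x"] by (simp add: norm_mult)
  then have "(cmod (\<integral>x. f x * g x \<partial>N))\<^sup>2 \<le> (\<integral>x. cmod (f x) * cmod (g x) \<partial>N)\<^sup>2"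
    by (intro power_mono) auto
  then show ?thesis using L2_Cauchy_Schwarz_norm[OF assms] by linarith
qed

lemma (in prob_space) L1_le_L2:
  assumes "in_L2 M f"
  shows "(\<integral>x. cmod (f x) \<partial>M) \<le> sqrt (\<integral>x. (cmod (f x))\<^sup>2 \<partial>M)"
  using L2_Cauchy_Schwarz_norm[OF assms in_L2_const[of 1]]
  by (intro real_le_rsqrt) (simp add: prob_space)

text \<open>Working with squared distances avoids square roots at the price of a factor 2, which is
  harmless in limits and bounds.\<close>

lemma L2_dist_triangle:
  assumes "in_L2 N f" "in_L2 N g" "in_L2 N h"
  shows "(\<integral>x. (cmod (f x - h x))\<^sup>2 \<partial>N) \<le>
    2 * (\<integral>x. (cmod (f x - g x))\<^sup>2 \<partial>N) + 2 * (\<integral>x. (cmod (g x - h x))\<^sup>2 \<partial>N)"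
proof -
  have i: "integrable N (\<lambda>x. (cmod (f x - h x))\<^sup>2)" "integrable N (\<lambda>x. (cmod (f x - g x))\<^sup>2)"
    "integrable N (\<lambda>x. (cmod (g x - h x))\<^sup>2)"
    using assms by (auto intro!: in_L2_integrable_power2 in_L2_diff)
  have "(\<integral>x. (cmod (f x - h x))\<^sup>2 \<partial>N) \<le>
      (\<integral>x. 2 * (cmod (f x - g x))\<^sup>2 + 2 * (cmod (g x - h x))\<^sup>2 \<partial>N)"
  proof (intro integral_mono)
    show "(cmod (f x - h x))\<^sup>2 \<le> 2 * (cmod (f x - g x))\<^sup>2 + 2 * (cmod (g x - h x))\<^sup>2" for x
      using cmod_add_power2_le[of "f x - g x" "g x - h x"] by simp
  qed (use i in auto)
  then show ?thesis using i by simp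
qed

text \<open>Riesz-Fischer argument: a subsequence converges almost everywhere, and Fatou's lemma
  transfers the Cauchy estimate of the whole sequence to the pointwise limit.\<close>

lemma (in prob_space) L2_complete:
  assumes u: "\<And>n. in_L2 M (u n)"
    and Cauchy: "\<And>\<epsilon>. \<epsilon> > 0 \<Longrightarrow> \<exists>N. \<forall>m\<ge>N. \<forall>n\<ge>N. (\<integral>x. (cmod (u m x - u n x))\<^sup>2 \<partial>M) < \<epsilon>"
  obtains Z where "in_L2 M Z" "(\<lambda>n. \<integral>x. (cmod (Z x - u n x))\<^sup>2 \<partial>M) \<longlonglongrightarrow> 0"
proof -
  have [measurable]: "u n \<in> borel_measurable M" for n
    using u by (simp add: in_L2_def)
  \<comment> \<open>On a probability space the L1 norm is at most the L2 norm, so the sequence is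
    Cauchy in L1 and has an almost everywhere convergent subsequence.\<close>
  have "\<exists>N. \<forall>i\<ge>N. \<forall>j\<ge>N. (\<integral>x. norm (u i x - u j x) \<partial>M) < \<epsilon>" if "\<epsilon> > 0" for \<epsilon> :: real
  proof -
    obtain N where N: "\<And>m n. m \<ge> N \<Longrightarrow> n \<ge> N \<Longrightarrow> (\<integral>x. (cmod (u m x - u n x))\<^sup>2 \<partial>M) < \<epsilon>\<^sup>2"
      using Cauchy[of "\<epsilon>\<^sup>2"] \<open>\<epsilon> > 0\<close> by auto
    have "(\<integral>x. norm (u i x - u j x) \<partial>M) < \<epsilon>" if "i \<ge> N" "j \<ge> N" for i j
    proof -
      have "sqrt (\<integral>x. (cmod (u i x - u j x))\<^sup>2 \<partial>M) < sqrt (\<epsilon>\<^sup>2)"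
        using N[OF that] by (intro real_sqrt_less_mono)
      then show ?thesis
        using L1_le_L2[OF in_L2_diff[OF u u], of i j] \<open>\<epsilon> > 0\<close> by simp
    qed
    then show ?thesis by blast
  qed
  then obtain r where r: "strict_mono r" "AE x in M. Cauchy (\<lambda>i. u (r i) x)"
    using cauchy_L1_AE_cauchy_subseq[of M u] in_L2_integrable[OF u] by blast
  define Z where "Z x = lim (\<lambda>i. u (r i) x)" for x
  have [measurable]: "Z \<in> borel_measurable M"
    unfolding Z_def by measurable
  have lim: "AE x in M. (\<lambda>i. u (r i) x) \<longlonglongrightarrow> Z x"
    using r(2) by eventually_elim (simp add: Z_def Cauchy_convergent_iff convergent_LIMSEQ_iff)
  have key: "\<exists>N. \<forall>n\<ge>N. integrable M (\<lambda>x. (cmod (Z x - u n x))\<^sup>2) \<and> (\<integral>x. (cmod (Z x - u n x))\<^sup>2 \<partial>M) \<le> \<epsilon>"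
    if "\<epsilon> > 0" for \<epsilon> :: real
  proof -
    obtain N where N: "\<And>m n. m \<ge> N \<Longrightarrow> n \<ge> N \<Longrightarrow> (\<integral>x. (cmod (u m x - u n x))\<^sup>2 \<partial>M) < \<epsilon>"
      using Cauchy[of "\<epsilon>"] \<open>\<epsilon> > 0\<close> by auto
    \<comment> \<open>Fatou's lemma along the subsequence, with nonnegative integrals because
      integrability of the limit is still to be proved; it follows from this bound.\<close>
    have "(\<integral>\<^sup>+x. ennreal ((cmod (Z x - u n x))\<^sup>2) \<partial>M) \<le> ennreal \<epsilon>" if "n \<ge> N" for n
    proof -
      have "AE x in M. (\<lambda>i. ennreal ((cmod (u (r i) x - u n x))\<^sup>2)) \<longlonglongrightarrow> ennreal ((cmod (Z x - u n x))\<^sup>2)"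
        using lim by eventually_elim (intro tendsto_intros tendsto_ennrealI)
      then have "(\<integral>\<^sup>+x. ennreal ((cmod (Z x - u n x))\<^sup>2) \<partial>M) =
          (\<integral>\<^sup>+x. liminf (\<lambda>i. ennreal ((cmod (u (r i) x - u n x))\<^sup>2)) \<partial>M)"
        by (intro nn_integral_cong_AE) (auto elim!: eventually_mono dest!: lim_imp_Liminf[rotated] simp del: tendsto_ennreal_iff)
      also have "\<dots> \<le> liminf (\<lambda>i. \<integral>\<^sup>+x. ennreal ((cmod (u (r i) x - u n x))\<^sup>2) \<partial>M)"
        by (intro nn_integral_liminf) measurable
      also have "\<dots> \<le> ennreal \<epsilon>"
      proof (rule Liminf_le)
        show "sequentially \<noteq> bot" by simp
        show "\<forall>\<^sub>F i in sequentially. (\<integral>\<^sup>+x. ennreal ((cmod (u (r i) x - u n x))\<^sup>2) \<partial>M) \<le> ennreal \<epsilon>"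
        proof (rule eventually_sequentiallyI[of N])
          fix i assume "i \<ge> N"
          then have "r i \<ge> N" using seq_suble[OF r(1), of i] by linarith
          then have "(\<integral>x. (cmod (u (r i) x - u n x))\<^sup>2 \<partial>M) \<le> \<epsilon>" using N[of "r i" n] \<open>n \<ge> N\<close> by auto
          then show "(\<integral>\<^sup>+x. ennreal ((cmod (u (r i) x - u n x))\<^sup>2) \<partial>M) \<le> ennreal \<epsilon>"
            by (subst nn_integral_eq_integral)
               (auto intro!: in_L2_integrable_power2 in_L2_diff u ennreal_leI)
        qed
      qed
      finally show ?thesis .
    qed
    note * = this
    have "integrable M (\<lambda>x. (cmod (Z x - u n x))\<^sup>2)" if "n \<ge> N" for n
      using *[OF that] by (intro integrableI_bounded) (auto simp: top_unique less_top[symmetric])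
    moreover from this have "(\<integral>x. (cmod (Z x - u n x))\<^sup>2 \<partial>M) \<le> \<epsilon>" if "n \<ge> N" for n
      using *[OF that] that \<open>\<epsilon> > 0\<close> by (subst (asm) nn_integral_eq_integral) auto
    ultimately show ?thesis by blast
  qed
  obtain n where n: "integrable M (\<lambda>x. (cmod (Z x - u n x))\<^sup>2)"
    using key[of 1] by auto
  \<comment> \<open>A single square integrable difference already puts the limit into L2.\<close>
  have "in_L2 M (\<lambda>x. (Z x - u n x) + u n x)"
    by (rule in_L2_add[OF _ u]) (simp add: in_L2_def n)
  then have Z: "in_L2 M Z" by simp
  moreover have "(\<lambda>n. \<integral>x. (cmod (Z x - u n x))\<^sup>2 \<partial>M) \<longlonglongrightarrow> 0"
  proof (rule LIMSEQ_I)
    fix \<epsilon> :: real assume "\<epsilon> > 0"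
    then obtain N where N: "\<And>n. n \<ge> N \<Longrightarrow> (\<integral>x. (cmod (Z x - u n x))\<^sup>2 \<partial>M) \<le> \<epsilon> / 2"
      using key[of "\<epsilon> / 2"] by auto
    have "norm ((\<integral>x. (cmod (Z x - u n x))\<^sup>2 \<partial>M) - 0) < \<epsilon>" if "n \<ge> N" for n
      using N[OF that] \<open>\<epsilon> > 0\<close> by simp
    then show "\<exists>N. \<forall>n\<ge>N. norm ((\<integral>x. (cmod (Z x - u n x))\<^sup>2 \<partial>M) - 0) < \<epsilon>"
      by blast
  qed
  ultimately show ?thesis using that by blast
qed

section \<open>Gaussian series\<close>

definition partial_noise :: "(nat \<Rightarrow> 'w \<Rightarrow> real) \<Rightarrow> (nat \<Rightarrow> complex) \<Rightarrow> nat \<Rightarrow> 'w \<Rightarrow> complex" where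
  "partial_noise \<xi> c n \<omega> = (\<Sum>k<n. c k * of_real (\<xi> k \<omega>))"

text \<open>A relation instead of a chosen limit, since the limit is determined only up to null
  sets; it also depends on the coefficients alone and not on a function having them.\<close>

definition noise_limit :: "'w measure \<Rightarrow> (nat \<Rightarrow> 'w \<Rightarrow> real) \<Rightarrow> (nat \<Rightarrow> complex) \<Rightarrow> ('w \<Rightarrow> complex) \<Rightarrow> bool" where
  "noise_limit M \<xi> c Z \<longleftrightarrow> in_L2 M Z \<and>
     (\<lambda>n. \<integral>\<omega>. (cmod (Z \<omega> - partial_noise \<xi> c n \<omega>))\<^sup>2 \<partial>M) \<longlonglongrightarrow> 0"

lemma white_noise_eq_noise_limit:
  "white_noise \<mu> M e \<xi> \<phi> = (SOME Z. noise_limit M \<xi> (fourier_coeff \<mu> e \<phi>) Z)"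
  by (simp add: white_noise_def noise_limit_def partial_noise_def)

section \<open>Second moments of the Gaussian sequence\<close>

locale gaussian_sequence = prob_space M for M :: "'w measure" +
  fixes \<xi> :: "nat \<Rightarrow> 'w \<Rightarrow> real"
  assumes iid: "iid_std_normal M \<xi>"
begin

lemma indep_xi: "indep_vars (\<lambda>_. borel) \<xi> UNIV"
  using iid by (simp add: iid_std_normal_def)

lemma xi_measurable [measurable]: "\<xi> k \<in> borel_measurable M"
  using indep_xi by (simp add: indep_vars_def)

lemma distr_xi: "distr M borel (\<xi> k) = std_normal_distribution"
  using iid by (simp add: iid_std_normal_def)

lemma integrable_xi_power: "integrable M (\<lambda>\<omega>. \<xi> k \<omega> ^ n)"
proof -
  have "integrable (distr M borel (\<xi> k)) (\<lambda>x. x ^ n)"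
    unfolding distr_xi by (rule integrable_std_normal_distribution_moment)
  then show ?thesis by (simp add: integrable_distr_eq)
qed

lemma expectation_xi: "expectation (\<xi> k) = 0"
proof -
  have "expectation (\<xi> k) = (\<integral>x. x \<partial>distr M borel (\<xi> k))"
    by (simp add: integral_distr)
  also have "\<dots> = 0"
    unfolding distr_xi using integral_std_normal_distribution_moment_odd[of 1] by simp
  finally show ?thesis .
qed

lemma expectation_xi_power2: "expectation (\<lambda>\<omega>. (\<xi> k \<omega>)\<^sup>2) = 1"
proof -
  have "expectation (\<lambda>\<omega>. (\<xi> k \<omega>)\<^sup>2) = (\<integral>x. x\<^sup>2 \<partial>distr M borel (\<xi> k))"
    by (simp add: integral_distr)
  also have "\<dots> = 1"
    unfolding distr_xi using std_normal_distribution_even_moments(1)[of 1] by simp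
  finally show ?thesis .
qed

lemma indep_var_xi:
  assumes "j \<noteq> k"
  shows "indep_var borel (\<xi> j) borel (\<xi> k)"
proof -
  have "indep_var (Pi\<^sub>M {j} (\<lambda>_. borel)) (\<lambda>\<omega>. \<lambda>i\<in>{j}. \<xi> i \<omega>) (Pi\<^sub>M {k} (\<lambda>_. borel)) (\<lambda>\<omega>. \<lambda>i\<in>{k}. \<xi> i \<omega>)"
    using assms by (intro indep_var_restrict[OF indep_xi]) auto
  then have "indep_var borel ((\<lambda>x. x j) \<circ> (\<lambda>\<omega>. \<lambda>i\<in>{j}. \<xi> i \<omega>)) borel ((\<lambda>x. x k) \<circ> (\<lambda>\<omega>. \<lambda>i\<in>{k}. \<xi> i \<omega>))"
    by (rule indep_var_compose) simp_all
  then show ?thesis by (simp add: comp_def)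
qed

lemma integrable_xi_mult: "integrable M (\<lambda>\<omega>. \<xi> j \<omega> * \<xi> k \<omega>)"
  using indep_var_integrable[OF indep_var_xi[of j k]] integrable_xi_power[of _ 1]
    integrable_xi_power[of j 2]
  by (cases "j = k") (simp_all add: power2_eq_square)

lemma expectation_xi_mult: "expectation (\<lambda>\<omega>. \<xi> j \<omega> * \<xi> k \<omega>) = (if j = k then 1 else 0)"
  using indep_var_lebesgue_integral[OF indep_var_xi[of j k]] integrable_xi_power[of _ 1]
    expectation_xi expectation_xi_power2[of j]
  by (cases "j = k") (simp_all add: power2_eq_square)

lemma in_L2_xi: "in_L2 M (\<lambda>\<omega>. of_real (\<xi> k \<omega>))"
  using integrable_xi_power[of k 2] by (simp add: in_L2_def)

lemma in_L2_partial_noise: "in_L2 M (partial_noise \<xi> c n)"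
  unfolding partial_noise_def[abs_def] by (intro in_L2_sum in_L2_cmult in_L2_xi)

lemma partial_noise_measurable [measurable]: "partial_noise \<xi> c n \<in> borel_measurable M"
  by (rule in_L2_measurable[OF in_L2_partial_noise])

text \<open>The variables \<xi> are orthonormal in L2. An arbitrary finite index set is allowed so
  that blocks of a series, that is differences of partial sums, are covered.\<close>

lemma expectation_sum_xi_power2:
  fixes c :: "nat \<Rightarrow> complex"
  assumes "finite A"
  shows "expectation (\<lambda>\<omega>. (cmod (\<Sum>k\<in>A. c k * of_real (\<xi> k \<omega>)))\<^sup>2) = (\<Sum>k\<in>A. (cmod (c k))\<^sup>2)"
proof -
  have "(cmod (\<Sum>k\<in>A. c k * of_real (\<xi> k \<omega>)))\<^sup>2 =
      (\<Sum>j\<in>A. \<Sum>k\<in>A. Re (c j * cnj (c k)) * (\<xi> j \<omega> * \<xi> k \<omega>))" for \<omega>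
  proof -
    have "(cmod (\<Sum>k\<in>A. c k * of_real (\<xi> k \<omega>)))\<^sup>2 =
        Re ((\<Sum>k\<in>A. c k * of_real (\<xi> k \<omega>)) * cnj (\<Sum>k\<in>A. c k * of_real (\<xi> k \<omega>)))"
      by (subst complex_norm_square[symmetric]) simp
    also have "\<dots> = (\<Sum>j\<in>A. \<Sum>k\<in>A. Re (c j * cnj (c k)) * (\<xi> j \<omega> * \<xi> k \<omega>))"
      by (simp add: cnj_sum sum_product Re_sum algebra_simps)
    finally show ?thesis .
  qed
  then have "expectation (\<lambda>\<omega>. (cmod (\<Sum>k\<in>A. c k * of_real (\<xi> k \<omega>)))\<^sup>2) =
      (\<Sum>j\<in>A. \<Sum>k\<in>A. Re (c j * cnj (c k)) * (if j = k then 1 else 0))"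
    by (simp add: integrable_xi_mult expectation_xi_mult)
  also have "\<dots> = (\<Sum>j\<in>A. Re (c j * cnj (c j)))"
    using assms by (simp add: if_distrib cong: if_cong)
  also have "\<dots> = (\<Sum>k\<in>A. (cmod (c k))\<^sup>2)"
    by (simp add: cmod_def power2_eq_square)
  finally show ?thesis .
qed

lemma expectation_partial_noise_diff:
  assumes "n \<le> m"
  shows "expectation (\<lambda>\<omega>. (cmod (partial_noise \<xi> c m \<omega> - partial_noise \<xi> c n \<omega>))\<^sup>2) =
    (\<Sum>k<m. (cmod (c k))\<^sup>2) - (\<Sum>k<n. (cmod (c k))\<^sup>2)"
proof -
  have eq: "(\<Sum>k<m. g k) - (\<Sum>k<n. g k) = (\<Sum>k\<in>{n..<m}. g k)" for g :: "nat \<Rightarrow> 'b::ab_group_add"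
    using sum_diff_nat_ivl[of 0 n m g] assms by (simp add: atLeast0LessThan)
  show ?thesis
    unfolding partial_noise_def eq by (rule expectation_sum_xi_power2) simp
qed

text \<open>By the isometry, the partial sums of the noise are Cauchy in L2 because the sums of
  \<open>(cmod (c k))\<^sup>2\<close> are Cauchy.\<close>

lemma noise_limit_exists:
  assumes "summable (\<lambda>k. (cmod (c k))\<^sup>2)"
  obtains Z where "noise_limit M \<xi> c Z"
proof -
  have "\<exists>N. \<forall>m\<ge>N. \<forall>n\<ge>N. expectation (\<lambda>\<omega>. (cmod (partial_noise \<xi> c m \<omega> - partial_noise \<xi> c n \<omega>))\<^sup>2) < \<epsilon>"
    if "\<epsilon> > 0" for \<epsilon> :: real
  proof -
    let ?s = "\<lambda>n. \<Sum>k<n. (cmod (c k))\<^sup>2"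
    have "Cauchy ?s"
      using assms by (simp add: summable_iff_convergent convergent_Cauchy)
    then obtain N where N: "\<And>m n. m \<ge> N \<Longrightarrow> n \<ge> N \<Longrightarrow> dist (?s m) (?s n) < \<epsilon>"
      using metric_CauchyD[OF _ \<open>\<epsilon> > 0\<close>] by blast
    have "expectation (\<lambda>\<omega>. (cmod (partial_noise \<xi> c m \<omega> - partial_noise \<xi> c n \<omega>))\<^sup>2) < \<epsilon>"
      if "m \<ge> N" "n \<ge> N" for m n
    proof (cases "n \<le> m")
      case True
      then show ?thesis
        using N[OF that] expectation_partial_noise_diff[OF True, of c] by (simp add: dist_real_def)
    next
      case False
      then have "m \<le> n" by simp
      from expectation_partial_noise_diff[OF this, of c] show ?thesis
        using N[OF that] by (simp add: dist_real_def norm_minus_commute)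
    qed
    then show ?thesis by blast
  qed
  from L2_complete[OF in_L2_partial_noise this] show ?thesis
    using that by (auto simp: noise_limit_def)
qed

text \<open>Needed to pass from the representative chosen by \<open>white_noise\<close> to the
  jointly measurable version.\<close>

lemma noise_limit_cong_AE:
  assumes "noise_limit M \<xi> c Z" "W \<in> borel_measurable M" "AE \<omega> in M. W \<omega> = Z \<omega>"
  shows "noise_limit M \<xi> c W"
proof -
  have [measurable]: "Z \<in> borel_measurable M"
    using assms by (simp add: noise_limit_def in_L2_def)
  note [measurable] = assms(2)
  have "expectation (\<lambda>\<omega>. (cmod (W \<omega> - partial_noise \<xi> c n \<omega>))\<^sup>2) =
      expectation (\<lambda>\<omega>. (cmod (Z \<omega> - partial_noise \<xi> c n \<omega>))\<^sup>2)" for n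
    by (rule integral_cong_AE) (use assms(3) in auto)
  then show ?thesis
    using assms in_L2_cong_AE[of M Z W] by (simp add: noise_limit_def)
qed

text \<open>Both variables are limits of the same partial sums, so their squared distance is below a
  sequence tending to 0. Almost sure identities between values of the field follow by comparing
  coefficients.\<close>

lemma noise_limit_unique:
  assumes "noise_limit M \<xi> c Z" "noise_limit M \<xi> c W"
  shows "AE \<omega> in M. Z \<omega> = W \<omega>"
proof -
  let ?d = "\<lambda>Z n. expectation (\<lambda>\<omega>. (cmod (Z \<omega> - partial_noise \<xi> c n \<omega>))\<^sup>2)"
  have L2: "in_L2 M Z" "in_L2 M W" using assms by (auto simp: noise_limit_def)
  have i: "integrable M (\<lambda>\<omega>. (cmod (Z \<omega> - W \<omega>))\<^sup>2)"
    by (intro in_L2_integrable_power2 in_L2_diff L2)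
  have le: "expectation (\<lambda>\<omega>. (cmod (Z \<omega> - W \<omega>))\<^sup>2) \<le> 2 * ?d Z n + 2 * ?d W n" for n
    using L2_dist_triangle[OF L2(1) in_L2_partial_noise L2(2), of c n] by (simp add: norm_minus_commute)
  have "(\<lambda>n. 2 * ?d Z n + 2 * ?d W n) \<longlonglongrightarrow> 2 * 0 + 2 * 0"
    using assms by (intro tendsto_intros) (auto simp: noise_limit_def)
  then have "expectation (\<lambda>\<omega>. (cmod (Z \<omega> - W \<omega>))\<^sup>2) \<le> 2 * 0 + 2 * 0"
    by (rule tendsto_lowerbound[OF _ eventuallyI[OF le]]) simp
  moreover have "0 \<le> expectation (\<lambda>\<omega>. (cmod (Z \<omega> - W \<omega>))\<^sup>2)"
    by simp
  ultimately have "expectation (\<lambda>\<omega>. (cmod (Z \<omega> - W \<omega>))\<^sup>2) = 0"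
    by linarith
  then have "AE \<omega> in M. (cmod (Z \<omega> - W \<omega>))\<^sup>2 = 0"
    using integral_nonneg_eq_0_iff_AE[OF i] by simp
  then show ?thesis by eventually_elim simp
qed

lemma noise_limit_cmult:
  assumes "noise_limit M \<xi> c Z"
  shows "noise_limit M \<xi> (\<lambda>k. a * c k) (\<lambda>\<omega>. a * Z \<omega>)"
proof -
  have "partial_noise \<xi> (\<lambda>k. a * c k) n \<omega> = a * partial_noise \<xi> c n \<omega>" for n \<omega>
    by (simp add: partial_noise_def sum_distrib_left mult.assoc)
  then have "(cmod (a * Z \<omega> - partial_noise \<xi> (\<lambda>k. a * c k) n \<omega>))\<^sup>2 =
      (cmod a)\<^sup>2 * (cmod (Z \<omega> - partial_noise \<xi> c n \<omega>))\<^sup>2" for n \<omega>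
    by (simp flip: right_diff_distrib add: norm_mult power_mult_distrib)
  then show ?thesis
    using assms by (auto simp: noise_limit_def in_L2_cmult intro!: tendsto_mult_right_zero)
qed

lemma noise_limit_add:
  assumes "noise_limit M \<xi> c Z" "noise_limit M \<xi> d W"
  shows "noise_limit M \<xi> (\<lambda>k. c k + d k) (\<lambda>\<omega>. Z \<omega> + W \<omega>)"
proof -
  let ?d = "\<lambda>Z c n. expectation (\<lambda>\<omega>. (cmod (Z \<omega> - partial_noise \<xi> c n \<omega>))\<^sup>2)"
  have L2: "in_L2 M Z" "in_L2 M W" using assms by (auto simp: noise_limit_def)
  have le: "?d (\<lambda>\<omega>. Z \<omega> + W \<omega>) (\<lambda>k. c k + d k) n \<le> 2 * ?d Z c n + 2 * ?d W d n" for n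
  proof -
    have "partial_noise \<xi> (\<lambda>k. c k + d k) n \<omega> = partial_noise \<xi> c n \<omega> + partial_noise \<xi> d n \<omega>" for \<omega>
      by (simp add: partial_noise_def sum.distrib distrib_right)
    \<comment> \<open>The error is written as a difference of the two errors, so that the squared
      triangle inequality applies with the zero function as midpoint.\<close>
    then have eq: "Z \<omega> + W \<omega> - partial_noise \<xi> (\<lambda>k. c k + d k) n \<omega> =
        (Z \<omega> - partial_noise \<xi> c n \<omega>) - (partial_noise \<xi> d n \<omega> - W \<omega>)" for \<omega>
      by simp
    have "?d (\<lambda>\<omega>. Z \<omega> + W \<omega>) (\<lambda>k. c k + d k) n \<le>
        2 * expectation (\<lambda>\<omega>. (cmod (Z \<omega> - partial_noise \<xi> c n \<omega> - 0))\<^sup>2) +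
        2 * expectation (\<lambda>\<omega>. (cmod (0 - (partial_noise \<xi> d n \<omega> - W \<omega>)))\<^sup>2)"
      unfolding eq by (intro L2_dist_triangle in_L2_diff in_L2_partial_noise L2 in_L2_zero)
    then show ?thesis by simp
  qed
  have "(\<lambda>n. 2 * ?d Z c n + 2 * ?d W d n) \<longlonglongrightarrow> 2 * 0 + 2 * 0"
    using assms by (intro tendsto_intros) (auto simp: noise_limit_def)
  then have lim: "(\<lambda>n. 2 * ?d Z c n + 2 * ?d W d n) \<longlonglongrightarrow> 0"
    by simp
  have "?d (\<lambda>\<omega>. Z \<omega> + W \<omega>) (\<lambda>k. c k + d k) \<longlonglongrightarrow> 0"
  proof (rule Lim_null_comparison[OF eventuallyI lim])
    show "norm (?d (\<lambda>\<omega>. Z \<omega> + W \<omega>) (\<lambda>k. c k + d k) n) \<le> 2 * ?d Z c n + 2 * ?d W d n" for n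
      unfolding real_norm_def by (subst abs_of_nonneg) (simp, rule le)
  qed
  then show ?thesis
    using L2 by (simp add: noise_limit_def in_L2_add)
qed

lemma noise_limit_zero: "noise_limit M \<xi> (\<lambda>_. 0) (\<lambda>_. 0)"
  by (simp add: noise_limit_def partial_noise_def in_L2_zero)

lemma noise_limit_sum:
  "(\<And>i. i \<in> A \<Longrightarrow> noise_limit M \<xi> (c i) (Z i)) \<Longrightarrow>
    noise_limit M \<xi> (\<lambda>k. \<Sum>i\<in>A. c i k) (\<lambda>\<omega>. \<Sum>i\<in>A. Z i \<omega>)"
  by (induction A rule: infinite_finite_induct) (simp_all add: noise_limit_zero noise_limit_add)

text \<open>A crude tail bound: the factor 2 comes from \<open>L2_dist_triangle\<close>. Its purpose
  is to dominate the error uniformly in n once the total sum is controlled.\<close>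

lemma noise_limit_dist_le:
  assumes "noise_limit M \<xi> c Z" "summable (\<lambda>k. (cmod (c k))\<^sup>2)"
  shows "expectation (\<lambda>\<omega>. (cmod (Z \<omega> - partial_noise \<xi> c n \<omega>))\<^sup>2) \<le>
    2 * ((\<Sum>k. (cmod (c k))\<^sup>2) - (\<Sum>k<n. (cmod (c k))\<^sup>2))"
proof -
  let ?d = "\<lambda>n. expectation (\<lambda>\<omega>. (cmod (Z \<omega> - partial_noise \<xi> c n \<omega>))\<^sup>2)"
  let ?s = "\<lambda>n. \<Sum>k<n. (cmod (c k))\<^sup>2"
  have le: "?d n \<le> 2 * ?d m + 2 * (?s m - ?s n)" if "m \<ge> n" for m
    using L2_dist_triangle[OF _ in_L2_partial_noise in_L2_partial_noise, of Z c n c m] assms(1)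
      expectation_partial_noise_diff[OF that, of c]
    by (simp add: noise_limit_def)
  have "(\<lambda>m. 2 * ?d m + 2 * (?s m - ?s n)) \<longlonglongrightarrow> 2 * 0 + 2 * ((\<Sum>k. (cmod (c k))\<^sup>2) - ?s n)"
    using assms by (intro tendsto_intros summable_LIMSEQ) (auto simp: noise_limit_def)
  then have "?d n \<le> 2 * 0 + 2 * ((\<Sum>k. (cmod (c k))\<^sup>2) - ?s n)"
    by (rule tendsto_lowerbound[OF _ eventually_sequentiallyI[OF le]]) simp_all
  then show ?thesis by simp
qed

section \<open>Characteristic functions of Gaussian series\<close>

lemma char_partial_noise:
  "(\<integral>\<omega>. iexp (Re (partial_noise \<xi> c n \<omega>)) \<partial>M) = of_real (exp (- (\<Sum>k<n. (Re (c k))\<^sup>2) / 2))"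
proof -
  have ind: "indep_vars (\<lambda>_. borel) (\<lambda>k \<omega>. Re (c k) * \<xi> k \<omega>) {..<n}"
    using indep_vars_compose2[OF indep_vars_subset[OF indep_xi], of "{..<n}" "\<lambda>k x. Re (c k) * x" "\<lambda>_. borel"]
    by simp
  \<comment> \<open>The argument stays at 1 and all scaling goes into the coefficient, so that one
    formula serves every argument of a characteristic function.\<close>
  have one: "char (distr M borel (\<lambda>\<omega>. a * \<xi> k \<omega>)) 1 = of_real (exp (- a\<^sup>2 / 2))" for a k
  proof -
    have "char (distr M borel (\<lambda>\<omega>. a * \<xi> k \<omega>)) 1 = char (distr M borel (\<xi> k)) a"
      by (simp add: char_def integral_distr)
    then show ?thesis by (simp add: distr_xi char_std_normal_distribution)
  qed
  have "Re (partial_noise \<xi> c n \<omega>) = (\<Sum>k<n. Re (c k) * \<xi> k \<omega>)" for \<omega>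
    by (simp add: partial_noise_def Re_sum)
  then have "(\<integral>\<omega>. iexp (Re (partial_noise \<xi> c n \<omega>)) \<partial>M) =
      char (distr M borel (\<lambda>\<omega>. \<Sum>k<n. Re (c k) * \<xi> k \<omega>)) 1"
    by (simp add: char_def integral_distr)
  also have "\<dots> = (\<Prod>k<n. of_real (exp (- (Re (c k))\<^sup>2 / 2)))"
    by (simp add: char_distr_sum[OF ind] one)
  also have "\<dots> = of_real (exp (\<Sum>k<n. - (Re (c k))\<^sup>2 / 2))"
    by (simp only: exp_sum finite_lessThan of_real_prod)
  also have "(\<Sum>k<n. - (Re (c k))\<^sup>2 / 2) = - (\<Sum>k<n. (Re (c k))\<^sup>2) / 2"
    by (simp add: sum_negf sum_divide_distrib)
  finally show ?thesis .
qed

text \<open>The map \<open>iexp\<close> is 1-Lipschitz, so L2 convergence of the partial sums, which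
  implies L1 convergence, carries their characteristic functions to that of the limit.\<close>

lemma char_noise_limit:
  assumes "noise_limit M \<xi> c Z" and sums: "(\<lambda>k. (Re (c k))\<^sup>2) sums v"
  shows "(\<integral>\<omega>. iexp (Re (Z \<omega>)) \<partial>M) = of_real (exp (- v / 2))"
proof (rule LIMSEQ_unique)
  let ?d = "\<lambda>n. expectation (\<lambda>\<omega>. (cmod (Z \<omega> - partial_noise \<xi> c n \<omega>))\<^sup>2)"
  have L2: "in_L2 M Z" and lim: "?d \<longlonglongrightarrow> 0" using assms by (auto simp: noise_limit_def)
  have [measurable]: "Z \<in> borel_measurable M" using L2 by (rule in_L2_measurable)
  show "(\<lambda>n. \<integral>\<omega>. iexp (Re (partial_noise \<xi> c n \<omega>)) \<partial>M) \<longlonglongrightarrow> of_real (exp (- v / 2))"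
    unfolding char_partial_noise using sums by (intro tendsto_intros) (simp_all add: sums_def)
  have "cmod ((\<integral>\<omega>. iexp (Re (partial_noise \<xi> c n \<omega>)) \<partial>M) - (\<integral>\<omega>. iexp (Re (Z \<omega>)) \<partial>M)) \<le> sqrt (?d n)" for n
  proof -
    have "(\<integral>\<omega>. iexp (Re (partial_noise \<xi> c n \<omega>)) \<partial>M) - (\<integral>\<omega>. iexp (Re (Z \<omega>)) \<partial>M) =
        (\<integral>\<omega>. iexp (Re (partial_noise \<xi> c n \<omega>)) - iexp (Re (Z \<omega>)) \<partial>M)"
      by (intro Bochner_Integration.integral_diff[symmetric] integrable_iexp) auto
    also have "cmod \<dots> \<le> (\<integral>\<omega>. cmod (iexp (Re (partial_noise \<xi> c n \<omega>)) - iexp (Re (Z \<omega>))) \<partial>M)"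
      by (rule integral_norm_bound)
    also have "\<dots> \<le> (\<integral>\<omega>. cmod (Z \<omega> - partial_noise \<xi> c n \<omega>) \<partial>M)"
    proof (rule integral_mono)
      show "integrable M (\<lambda>\<omega>. cmod (iexp (Re (partial_noise \<xi> c n \<omega>)) - iexp (Re (Z \<omega>))))"
        by (intro integrable_norm Bochner_Integration.integrable_diff integrable_iexp) auto
      show "integrable M (\<lambda>\<omega>. cmod (Z \<omega> - partial_noise \<xi> c n \<omega>))"
        by (intro integrable_norm in_L2_integrable in_L2_diff L2 in_L2_partial_noise)
      fix \<omega>
      have "cmod (iexp (Re (partial_noise \<xi> c n \<omega>)) - iexp (Re (Z \<omega>))) =
          cmod (iexp (Re (Z \<omega>)) * (iexp (Re (partial_noise \<xi> c n \<omega>) - Re (Z \<omega>)) - 1))"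
        by (simp add: right_diff_distrib flip: exp_add)
      also have "\<dots> \<le> \<bar>Re (partial_noise \<xi> c n \<omega>) - Re (Z \<omega>)\<bar>"
        \<comment> \<open>Taylor's bound of order 0: \<open>cmod (iexp x - 1)\<close> is at most the
          absolute value of x.\<close>
        using iexp_approx1[of "Re (partial_noise \<xi> c n \<omega>) - Re (Z \<omega>)" 0] by (simp add: norm_mult)
      also have "\<dots> \<le> cmod (Z \<omega> - partial_noise \<xi> c n \<omega>)"
        using abs_Re_le_cmod[of "Z \<omega> - partial_noise \<xi> c n \<omega>"] by simp
      finally show "cmod (iexp (Re (partial_noise \<xi> c n \<omega>)) - iexp (Re (Z \<omega>))) \<le> cmod (Z \<omega> - partial_noise \<xi> c n \<omega>)" .
    qed
    also have "\<dots> \<le> sqrt (?d n)"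
      by (intro L1_le_L2 in_L2_diff L2 in_L2_partial_noise)
    finally show ?thesis .
  qed
  moreover have "(\<lambda>n. sqrt (?d n)) \<longlonglongrightarrow> 0"
    using tendsto_real_sqrt[OF lim] by simp
  ultimately have "(\<lambda>n. (\<integral>\<omega>. iexp (Re (partial_noise \<xi> c n \<omega>)) \<partial>M) - (\<integral>\<omega>. iexp (Re (Z \<omega>)) \<partial>M)) \<longlonglongrightarrow> 0"
    by (rule Lim_null_comparison[OF eventuallyI])
  then show "(\<lambda>n. \<integral>\<omega>. iexp (Re (partial_noise \<xi> c n \<omega>)) \<partial>M) \<longlonglongrightarrow> (\<integral>\<omega>. iexp (Re (Z \<omega>)) \<partial>M)"
    by (rule LIM_zero_cancel)
qed

end

section \<open>Uniqueness of characteristic functions of random vectors\<close>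

lemma real_distribution_normalized:
  fixes Y :: "'a \<Rightarrow> real"
  assumes "finite_measure P" "measure P (space P) = m" "0 < m" and [measurable]: "Y \<in> borel_measurable P"
  shows "real_distribution (distr (density P (\<lambda>_. ennreal (1 / m))) borel Y)"
proof -
  interpret finite_measure P by fact
  have "prob_space (density P (\<lambda>_. ennreal (1 / m)))"
    using assms by (intro prob_spaceI)
      (simp add: emeasure_density emeasure_eq_measure ennreal_mult[symmetric])
  then interpret D: prob_space "density P (\<lambda>_. ennreal (1 / m))" .
  show ?thesis by (rule D.real_distribution_distr) simp
qed

lemma char_normalized:
  fixes Y :: "'a \<Rightarrow> real"
  assumes "0 < m" and [measurable]: "Y \<in> borel_measurable P"
  shows "char (distr (density P (\<lambda>_. ennreal (1 / m))) borel Y) t = (1 / m) *\<^sub>R (\<integral>x. iexp (t * Y x) \<partial>P)"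
  using assms(1) by (simp add: char_def integral_distr integral_density)

text \<open>The value at t = 0 shows that both measures have the same mass m. If m = 0 both image
  measures vanish; otherwise dividing by m reduces the claim to probability laws. General finite
  measures are needed because the lemma is applied to weighted measures.\<close>

lemma finite_measure_Levy_uniqueness:
  fixes Y :: "'a \<Rightarrow> real" and Y' :: "'b \<Rightarrow> real"
  assumes "finite_measure P" "finite_measure Q"
    and [measurable]: "Y \<in> borel_measurable P" "Y' \<in> borel_measurable Q"
    and char: "\<And>t. (\<integral>x. iexp (t * Y x) \<partial>P) = (\<integral>x. iexp (t * Y' x) \<partial>Q)"
  shows "distr P borel Y = distr Q borel Y'"
proof -
  interpret P: finite_measure P by fact
  interpret Q: finite_measure Q by fact
  define m where "m = measure P (space P)"
  have mQ: "measure Q (space Q) = m"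
    using char[of 0] by (simp add: m_def)
  show ?thesis
  proof (cases "m = 0")
    case True
    show ?thesis
    proof (rule measure_eqI)
      fix A assume "A \<in> sets (distr P borel Y)"
      then have [measurable]: "A \<in> sets borel" by simp
      have "emeasure P (Y -` A \<inter> space P) \<le> emeasure P (space P)"
        "emeasure Q (Y' -` A \<inter> space Q) \<le> emeasure Q (space Q)"
        by (auto intro!: emeasure_mono)
      then have "emeasure P (Y -` A \<inter> space P) = 0" "emeasure Q (Y' -` A \<inter> space Q) = 0"
        using True mQ by (auto simp: m_def P.emeasure_eq_measure Q.emeasure_eq_measure measure_le_0_iff)
      then show "emeasure (distr P borel Y) A = emeasure (distr Q borel Y') A"
        by (simp add: emeasure_distr)
    qed simp
  next
    case False
    moreover have "0 \<le> m" by (simp add: m_def)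
    ultimately have m: "0 < m" by simp
    have eq: "distr (density P (\<lambda>_. ennreal (1 / m))) borel Y = distr (density Q (\<lambda>_. ennreal (1 / m))) borel Y'"
      using m mQ by (intro Levy_uniqueness real_distribution_normalized ext)
        (simp_all add: char_normalized char assms m_def[symmetric] del: of_real_mult)
    show ?thesis
    proof (rule measure_eqI)
      fix A assume "A \<in> sets (distr P borel Y)"
      then have [measurable]: "A \<in> sets borel" by simp
      have "emeasure (distr (density P (\<lambda>_. ennreal (1 / m))) borel Y) A =
            emeasure (distr (density Q (\<lambda>_. ennreal (1 / m))) borel Y') A"
        by (simp add: eq)
      then have "ennreal (1 / m) * emeasure P (Y -` A \<inter> space P) = ennreal (1 / m) * emeasure Q (Y' -` A \<inter> space Q)"
        by (simp add: emeasure_distr emeasure_density nn_integral_cmult_indicator)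
      then have "emeasure P (Y -` A \<inter> space P) = emeasure Q (Y' -` A \<inter> space Q)"
        using m by (subst (asm) ennreal_mult_cancel_left) auto
      then show "emeasure (distr P borel Y) A = emeasure (distr Q borel Y') A"
        by (simp add: emeasure_distr)
    qed simp
  qed
qed

lemma (in finite_measure) integrable_iexp_real:
  assumes [measurable]: "T \<in> borel_measurable M"
  shows "integrable M (\<lambda>x. iexp (T x))"
  by (rule integrable_const_bound[of _ 1]) auto

lemma finite_measure_density_bounded:
  assumes "finite_measure P" and [measurable]: "w \<in> borel_measurable P" and "\<And>x. w x \<le> (c :: real)"
  shows "finite_measure (density P (\<lambda>x. ennreal (w x)))"
proof -
  interpret finite_measure P by fact
  have "emeasure (density P (\<lambda>x. ennreal (w x))) (space P) = (\<integral>\<^sup>+x. ennreal (w x) \<partial>P)"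
    by (simp add: emeasure_density cong: nn_integral_cong)
  also have "\<dots> \<le> (\<integral>\<^sup>+x. ennreal c \<partial>P)"
    using assms(3) by (intro nn_integral_mono ennreal_leI) auto
  also have "\<dots> < \<infinity>"
    by (simp add: emeasure_eq_measure ennreal_mult_less_top)
  finally show ?thesis
    by (intro finite_measureI) simp
qed

text \<open>The hypothesis equates the characteristic functions of Y under the density g(T) and of
  Y' under g(T'). The two laws therefore agree, and the conclusion is their common value at
  A.\<close>

lemma weighted_indicator_eq:
  fixes Y T :: "'a \<Rightarrow> real" and Y' T' :: "'b \<Rightarrow> real"
  assumes "finite_measure P" "finite_measure Q"
    and [measurable]: "Y \<in> borel_measurable P" "Y' \<in> borel_measurable Q"
      "T \<in> borel_measurable P" "T' \<in> borel_measurable Q" "A \<in> sets borel" "g \<in> borel_measurable borel"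
    and g: "\<And>x. 0 \<le> g x" "\<And>x. g x \<le> c"
    and eq: "\<And>u. (\<integral>x. of_real (g (T x)) * iexp (u * Y x) \<partial>P) =
                  (\<integral>x. of_real (g (T' x)) * iexp (u * Y' x) \<partial>Q)"
  shows "(\<integral>x. g (T x) * indicator A (Y x) \<partial>P) = (\<integral>x. g (T' x) * indicator A (Y' x) \<partial>Q)"
proof -
  let ?P = "density P (\<lambda>x. ennreal (g (T x)))" and ?Q = "density Q (\<lambda>x. ennreal (g (T' x)))"
  have "distr ?P borel Y = distr ?Q borel Y'"
  proof (rule finite_measure_Levy_uniqueness)
    show "finite_measure ?P" "finite_measure ?Q"
      by (rule finite_measure_density_bounded[where c = c]; use assms in simp)+
    show "(\<integral>x. iexp (t * Y x) \<partial>?P) = (\<integral>x. iexp (t * Y' x) \<partial>?Q)" for t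
      using eq[of t] g by (simp add: integral_density scaleR_conv_of_real)
  qed simp_all
  moreover have "(\<integral>x. indicator A x \<partial>distr ?P borel Y) = (\<integral>x. g (T x) * indicator A (Y x) \<partial>P)"
    by (subst integral_distr) (use g in \<open>simp_all add: integral_density\<close>)
  moreover have "(\<integral>x. indicator A x \<partial>distr ?Q borel Y') = (\<integral>x. g (T' x) * indicator A (Y' x) \<partial>Q)"
    by (subst integral_distr) (use g in \<open>simp_all add: integral_density\<close>)
  ultimately show ?thesis by metis
qed

text \<open>The weights \<open>2 + cos T\<close> and \<open>2 + sin T\<close> keep all measures positive, so that the
  one-dimensional uniqueness theorem applies one coordinate at a time.\<close>

lemma indicator_char_eq:
  fixes Y T :: "'a \<Rightarrow> real" and Y' T' :: "'b \<Rightarrow> real"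
  assumes P: "finite_measure P" and Q: "finite_measure Q"
    and [measurable]: "Y \<in> borel_measurable P" "Y' \<in> borel_measurable Q"
      "T \<in> borel_measurable P" "T' \<in> borel_measurable Q" "A \<in> sets borel"
    and eq: "\<And>u v. (\<integral>x. iexp (u * Y x + v * T x) \<partial>P) = (\<integral>x. iexp (u * Y' x + v * T' x) \<partial>Q)"
  shows "(\<integral>x. indicator A (Y x) *\<^sub>R iexp (T x) \<partial>P) = (\<integral>x. indicator A (Y' x) *\<^sub>R iexp (T' x) \<partial>Q)"
proof -
  interpret P: finite_measure P by fact
  interpret Q: finite_measure Q by fact
  \<comment> \<open>Product-to-sum formulas: the weighted exponential is a combination of
    exponentials at y, y + t and y - t, whose integrals are given by \<open>eq\<close> with v = 0,
    1, -1.\<close>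
  have cosine: "of_real (2 + cos t) * iexp y = 2 * iexp y + (iexp (y + t) + iexp (y - t)) / 2" for t y :: real
    unfolding cis_conv_exp[symmetric] by (simp add: complex_eq_iff cos_add sin_add cos_diff sin_diff algebra_simps)
  have sine: "of_real (2 + sin t) * iexp y = 2 * iexp y + (iexp (y + t) - iexp (y - t)) * (- \<i> / 2)" for t y :: real
    unfolding cis_conv_exp[symmetric] by (simp add: complex_eq_iff cos_add sin_add cos_diff sin_diff field_simps)
  note int = P.integrable_iexp_real Q.integrable_iexp_real
  have e: "(\<integral>x. iexp (u * Y x) \<partial>P) = (\<integral>x. iexp (u * Y' x) \<partial>Q)"
    "(\<integral>x. iexp (u * Y x + T x) \<partial>P) = (\<integral>x. iexp (u * Y' x + T' x) \<partial>Q)"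
    "(\<integral>x. iexp (u * Y x - T x) \<partial>P) = (\<integral>x. iexp (u * Y' x - T' x) \<partial>Q)" for u
    using eq[of u 0] eq[of u 1] eq[of u "-1"] by simp_all
  have one: "(\<integral>x. 1 * indicator A (Y x) \<partial>P) = (\<integral>x. 1 * indicator A (Y' x) \<partial>Q :: real)"
    by (rule weighted_indicator_eq[OF P Q, where g = "\<lambda>_. 1" and c = 1 and T = T and T' = T'])
       (simp_all add: e del: of_real_mult)
  have cos: "(\<integral>x. (2 + cos (T x)) * indicator A (Y x) \<partial>P) = (\<integral>x. (2 + cos (T' x)) * indicator A (Y' x) \<partial>Q)"
  proof (rule weighted_indicator_eq[OF P Q, where g = "\<lambda>t. 2 + cos t" and c = 3])
    show "0 \<le> 2 + cos x" "2 + cos x \<le> 3" for x :: real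
      using cos_ge_minus_one[of x] cos_le_one[of x] by linarith+
    show "(\<integral>x. of_real (2 + cos (T x)) * iexp (u * Y x) \<partial>P) = (\<integral>x. of_real (2 + cos (T' x)) * iexp (u * Y' x) \<partial>Q)" for u
      unfolding cosine by (simp add: int e del: of_real_mult of_real_add of_real_diff)
  qed simp_all
  have sin: "(\<integral>x. (2 + sin (T x)) * indicator A (Y x) \<partial>P) = (\<integral>x. (2 + sin (T' x)) * indicator A (Y' x) \<partial>Q)"
  proof (rule weighted_indicator_eq[OF P Q, where g = "\<lambda>t. 2 + sin t" and c = 3])
    show "0 \<le> 2 + sin x" "2 + sin x \<le> 3" for x :: real
      using sin_ge_minus_one[of x] sin_le_one[of x] by linarith+
    show "(\<integral>x. of_real (2 + sin (T x)) * iexp (u * Y x) \<partial>P) = (\<integral>x. of_real (2 + sin (T' x)) * iexp (u * Y' x) \<partial>Q)" for u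
      unfolding sine by (simp add: int e del: of_real_mult of_real_add of_real_diff)
  qed simp_all
  \<comment> \<open>Euler's formula, with the added constant 2 removed again by means of the
    unweighted identity \<open>one\<close>; the factors 1 are kept so that the terms match that
    identity literally.\<close>
  have split: "indicator A y *\<^sub>R iexp t =
      of_real ((2 + cos t) * indicator A y - 2 * (1 * indicator A y)) +
      \<i> * of_real ((2 + sin t) * indicator A y - 2 * (1 * indicator A y))" for y t :: real
    unfolding cis_conv_exp[symmetric] by (simp add: complex_eq_iff indicator_def)
  have bnd: "integrable P (\<lambda>x. 1 * indicator A (Y x) :: real)"
    "integrable Q (\<lambda>x. 1 * indicator A (Y' x) :: real)"
    "integrable P (\<lambda>x. (2 + cos (T x)) * indicator A (Y x))"
    "integrable P (\<lambda>x. (2 + sin (T x)) * indicator A (Y x))"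
    "integrable Q (\<lambda>x. (2 + cos (T' x)) * indicator A (Y' x))"
    "integrable Q (\<lambda>x. (2 + sin (T' x)) * indicator A (Y' x))"
  proof -
    have b: "\<bar>2 + cos x\<bar> \<le> 3" "\<bar>2 + sin x\<bar> \<le> 3" for x :: real
      using cos_ge_minus_one[of x] cos_le_one[of x] sin_ge_minus_one[of x] sin_le_one[of x] by linarith+
    show "integrable P (\<lambda>x. 1 * indicator A (Y x) :: real)" "integrable P (\<lambda>x. (2 + cos (T x)) * indicator A (Y x))"
      "integrable P (\<lambda>x. (2 + sin (T x)) * indicator A (Y x))"
      by (rule P.integrable_const_bound[of _ 3]; use b in \<open>auto simp: indicator_def\<close>)+
    show "integrable Q (\<lambda>x. 1 * indicator A (Y' x) :: real)" "integrable Q (\<lambda>x. (2 + cos (T' x)) * indicator A (Y' x))"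
      "integrable Q (\<lambda>x. (2 + sin (T' x)) * indicator A (Y' x))"
      by (rule Q.integrable_const_bound[of _ 3]; use b in \<open>auto simp: indicator_def\<close>)+
  qed
  show ?thesis
    unfolding split using bnd one cos sin
    by (simp del: of_real_diff of_real_mult of_real_add mult_1 add: integral_complex_of_real)
qed

text \<open>Each induction step trades one exponential factor for an indicator: the condition on
  coordinate n becomes a density, and the induction hypothesis is applied under the weighted
  measures. Hence P and Q are finite measures that vary in the induction.\<close>

lemma char_eq_imp_rectangle_eq:
  fixes Y :: "nat \<Rightarrow> 'a \<Rightarrow> real" and Y' :: "nat \<Rightarrow> 'b \<Rightarrow> real"
  assumes "finite_measure P" "finite_measure Q"
    and "\<And>i. i < n \<Longrightarrow> Y i \<in> borel_measurable P" "\<And>i. i < n \<Longrightarrow> Y' i \<in> borel_measurable Q"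
    and "\<And>t :: nat \<Rightarrow> real. (\<integral>x. iexp (\<Sum>i<n. t i * Y i x) \<partial>P) = (\<integral>x. iexp (\<Sum>i<n. t i * Y' i x) \<partial>Q)"
    and "\<And>i. i < n \<Longrightarrow> A i \<in> sets borel"
  shows "measure P {x \<in> space P. \<forall>i<n. Y i x \<in> A i} = measure Q {x \<in> space Q. \<forall>i<n. Y' i x \<in> A i}"
  using assms
proof (induction n arbitrary: P Q)
  case 0
  \<comment> \<open>The empty sum turns the integrand into 1, so the total masses are
    compared.\<close>
  from 0(5)[of "\<lambda>_. 0"] show ?case by simp
next
  case (Suc n)
  interpret P: finite_measure P by fact
  interpret Q: finite_measure Q by fact
  note [measurable] = Suc.prems(3,4,6)
  have [measurable]: "Y n \<in> borel_measurable P" "Y' n \<in> borel_measurable Q" "A n \<in> sets borel"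
    using Suc.prems by auto
  have [measurable]: "Y i \<in> borel_measurable P" "Y' i \<in> borel_measurable Q" "A i \<in> sets borel" if "i < n" for i
    using Suc.prems that by auto
  let ?P = "density P (\<lambda>x. ennreal (indicator (A n) (Y n x)))"
  let ?Q = "density Q (\<lambda>x. ennreal (indicator (A n) (Y' n x)))"
  have "measure ?P {x \<in> space ?P. \<forall>i<n. Y i x \<in> A i} = measure ?Q {x \<in> space ?Q. \<forall>i<n. Y' i x \<in> A i}"
  proof (rule Suc.IH)
    show "finite_measure ?P" "finite_measure ?Q"
      by (rule finite_measure_density_bounded[where c = 1]; use Suc.prems in \<open>simp add: indicator_def\<close>)+
    fix t :: "nat \<Rightarrow> real"
    \<comment> \<open>The coefficient vector with entries v t_i for i < n and u at n gives the
      two-variable identity for \<open>Y n\<close> and the combination of the other coordinates that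
      \<open>indicator_char_eq\<close> asks for.\<close>
    have "(\<integral>x. iexp (u * Y n x + v * (\<Sum>i<n. t i * Y i x)) \<partial>P) =
        (\<integral>x. iexp (u * Y' n x + v * (\<Sum>i<n. t i * Y' i x)) \<partial>Q)" for u v
      using Suc.prems(5)[of "(\<lambda>i. v * t i)(n := u)"]
      by (simp add: sum_distrib_left mult.assoc add.commute)
    then have "(\<integral>x. indicator (A n) (Y n x) *\<^sub>R iexp (\<Sum>i<n. t i * Y i x) \<partial>P) =
        (\<integral>x. indicator (A n) (Y' n x) *\<^sub>R iexp (\<Sum>i<n. t i * Y' i x) \<partial>Q)"
      by (intro indicator_char_eq Suc.prems) auto
    then show "(\<integral>x. iexp (\<Sum>i<n. t i * Y i x) \<partial>?P) = (\<integral>x. iexp (\<Sum>i<n. t i * Y' i x) \<partial>?Q)"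
      by (simp add: integral_density)
  qed auto
  moreover have "measure ?P {x \<in> space P. \<forall>i<n. Y i x \<in> A i} = measure P {x \<in> space P. \<forall>i<Suc n. Y i x \<in> A i}"
  proof -
    have m: "{x \<in> space P. \<forall>i\<in>{..<n}. Y i x \<in> A i} \<in> sets P"
      "{x \<in> space P. \<forall>i\<in>{..<Suc n}. Y i x \<in> A i} \<in> sets P"
      using Suc.prems by (auto intro!: sets.sets_Collect_finite_All')
    have "emeasure ?P {x \<in> space P. \<forall>i\<in>{..<n}. Y i x \<in> A i} =
        (\<integral>\<^sup>+x. ennreal (indicator (A n) (Y n x)) * indicator {x \<in> space P. \<forall>i\<in>{..<n}. Y i x \<in> A i} x \<partial>P)"
      by (rule emeasure_density) (use m in simp_all)
    also have "\<dots> = (\<integral>\<^sup>+x. indicator {x \<in> space P. \<forall>i\<in>{..<Suc n}. Y i x \<in> A i} x \<partial>P)"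
      by (rule nn_integral_cong) (auto simp: less_Suc_eq indicator_def)
    also have "\<dots> = emeasure P {x \<in> space P. \<forall>i\<in>{..<Suc n}. Y i x \<in> A i}"
      using m by simp
    finally show ?thesis by (simp only: measure_def Ball_def lessThan_iff)
  qed
  moreover have "measure ?Q {x \<in> space Q. \<forall>i<n. Y' i x \<in> A i} = measure Q {x \<in> space Q. \<forall>i<Suc n. Y' i x \<in> A i}"
  proof -
    have m: "{x \<in> space Q. \<forall>i\<in>{..<n}. Y' i x \<in> A i} \<in> sets Q"
      "{x \<in> space Q. \<forall>i\<in>{..<Suc n}. Y' i x \<in> A i} \<in> sets Q"
      using Suc.prems by (auto intro!: sets.sets_Collect_finite_All')
    have "emeasure ?Q {x \<in> space Q. \<forall>i\<in>{..<n}. Y' i x \<in> A i} =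
        (\<integral>\<^sup>+x. ennreal (indicator (A n) (Y' n x)) * indicator {x \<in> space Q. \<forall>i\<in>{..<n}. Y' i x \<in> A i} x \<partial>Q)"
      by (rule emeasure_density) (use m in simp_all)
    also have "\<dots> = (\<integral>\<^sup>+x. indicator {x \<in> space Q. \<forall>i\<in>{..<Suc n}. Y' i x \<in> A i} x \<partial>Q)"
      by (rule nn_integral_cong) (auto simp: less_Suc_eq indicator_def)
    also have "\<dots> = emeasure Q {x \<in> space Q. \<forall>i\<in>{..<Suc n}. Y' i x \<in> A i}"
      using m by simp
    finally show ?thesis by (simp only: measure_def Ball_def lessThan_iff)
  qed
  ultimately show ?case by simp
qed

text \<open>Measurable rectangles form an intersection-stable generator of the product
  sigma-algebra, so agreement on them suffices.\<close>

lemma char_eq_imp_distr_eq: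
  fixes Y :: "nat \<Rightarrow> 'a \<Rightarrow> real" and Y' :: "nat \<Rightarrow> 'b \<Rightarrow> real"
  assumes "finite_measure P" "finite_measure Q"
    and [measurable]: "\<And>i. i < n \<Longrightarrow> Y i \<in> borel_measurable P" "\<And>i. i < n \<Longrightarrow> Y' i \<in> borel_measurable Q"
    and char: "\<And>t :: nat \<Rightarrow> real. (\<integral>x. iexp (\<Sum>i<n. t i * Y i x) \<partial>P) = (\<integral>x. iexp (\<Sum>i<n. t i * Y' i x) \<partial>Q)"
  shows "distr P (Pi\<^sub>M {..<n} (\<lambda>_. borel)) (\<lambda>x. \<lambda>i\<in>{..<n}. Y i x) =
    distr Q (Pi\<^sub>M {..<n} (\<lambda>_. borel)) (\<lambda>x. \<lambda>i\<in>{..<n}. Y' i x)"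
proof -
  interpret P: finite_measure P by fact
  interpret Q: finite_measure Q by fact
  have [measurable]: "(\<lambda>x. \<lambda>i\<in>{..<n}. Y i x) \<in> P \<rightarrow>\<^sub>M Pi\<^sub>M {..<n} (\<lambda>_. borel)"
    "(\<lambda>x. \<lambda>i\<in>{..<n}. Y' i x) \<in> Q \<rightarrow>\<^sub>M Pi\<^sub>M {..<n} (\<lambda>_. borel)"
    by (auto intro!: measurable_restrict)
  show ?thesis
  proof (rule measure_eqI_PiM_finite)
    fix A :: "nat \<Rightarrow> real set"
    assume A: "\<And>i. i \<in> {..<n} \<Longrightarrow> A i \<in> sets borel"
    have "(\<lambda>x. \<lambda>i\<in>{..<n}. Y i x) -` Pi\<^sub>E {..<n} A \<inter> space P = {x \<in> space P. \<forall>i<n. Y i x \<in> A i}"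
      "(\<lambda>x. \<lambda>i\<in>{..<n}. Y' i x) -` Pi\<^sub>E {..<n} A \<inter> space Q = {x \<in> space Q. \<forall>i<n. Y' i x \<in> A i}"
      by (auto simp only: vimage_def Int_iff mem_Collect_eq restrict_PiE_iff lessThan_iff)
    moreover have "measure P {x \<in> space P. \<forall>i<n. Y i x \<in> A i} = measure Q {x \<in> space Q. \<forall>i<n. Y' i x \<in> A i}"
      by (rule char_eq_imp_rectangle_eq) (use assms A in auto)
    moreover have "Pi\<^sub>E {..<n} A \<in> sets (Pi\<^sub>M {..<n} (\<lambda>_. borel))"
      using A by (intro sets_PiM_I_finite) auto
    ultimately show "emeasure (distr P (Pi\<^sub>M {..<n} (\<lambda>_. borel)) (\<lambda>x. \<lambda>i\<in>{..<n}. Y i x)) (Pi\<^sub>E {..<n} A) =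
        emeasure (distr Q (Pi\<^sub>M {..<n} (\<lambda>_. borel)) (\<lambda>x. \<lambda>i\<in>{..<n}. Y' i x)) (Pi\<^sub>E {..<n} A)"
      by (simp add: emeasure_distr P.emeasure_eq_measure Q.emeasure_eq_measure)
  next
    \<comment> \<open>The measures are finite, so the constant sequence with value the whole space
      serves as the exhaustion.\<close>
    show "range (\<lambda>_ :: nat. Pi\<^sub>E {..<n} (\<lambda>_. UNIV)) \<subseteq> prod_algebra {..<n} (\<lambda>_. borel :: real measure)"
      by (auto intro!: prod_algebraI_finite)
    show "(\<Union>_ :: nat. Pi\<^sub>E {..<n} (\<lambda>_. UNIV)) = space (Pi\<^sub>M {..<n} (\<lambda>_. borel :: real measure))"
      by (simp add: space_PiM)
    have "finite_measure (distr P (Pi\<^sub>M {..<n} (\<lambda>_. borel)) (\<lambda>x. \<lambda>i\<in>{..<n}. Y i x))"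
      by (rule P.finite_measure_distr) simp
    then show "emeasure (distr P (Pi\<^sub>M {..<n} (\<lambda>_. borel)) (\<lambda>x. \<lambda>i\<in>{..<n}. Y i x)) (Pi\<^sub>E {..<n} (\<lambda>_. UNIV)) \<noteq> \<infinity>"
      unfolding infinity_ennreal_def by (rule finite_measure.emeasure_finite)
  qed simp_all
qed

text \<open>Real and imaginary parts are interleaved into a real vector of length 2 m, at even and
  odd positions; \<open>F\<close> reassembles the complex vector, so the equality of laws is pushed
  forward along it.\<close>

lemma complex_char_eq_imp_distr_eq:
  fixes Z :: "nat \<Rightarrow> 'a \<Rightarrow> complex" and Z' :: "nat \<Rightarrow> 'b \<Rightarrow> complex"
  assumes "finite_measure P" "finite_measure Q"
    and [measurable]: "\<And>i. i < m \<Longrightarrow> Z i \<in> borel_measurable P" "\<And>i. i < m \<Longrightarrow> Z' i \<in> borel_measurable Q"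
    and char: "\<And>w :: nat \<Rightarrow> complex.
      (\<integral>x. iexp (Re (\<Sum>i<m. w i * Z i x)) \<partial>P) = (\<integral>x. iexp (Re (\<Sum>i<m. w i * Z' i x)) \<partial>Q)"
  shows "distr P (Pi\<^sub>M {..<m} (\<lambda>_. borel)) (\<lambda>x. \<lambda>i\<in>{..<m}. Z i x) =
    distr Q (Pi\<^sub>M {..<m} (\<lambda>_. borel)) (\<lambda>x. \<lambda>i\<in>{..<m}. Z' i x)"
proof -
  define coord :: "(nat \<Rightarrow> complex) \<Rightarrow> nat \<Rightarrow> real"
    where "coord z j = (if even j then Re (z (j div 2)) else Im (z (j div 2)))" for z j
  define F :: "(nat \<Rightarrow> real) \<Rightarrow> nat \<Rightarrow> complex"
    where "F y = (\<lambda>i\<in>{..<m}. Complex (y (2 * i)) (y (2 * i + 1)))" for y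
  \<comment> \<open>The sign comes from Re ((a - i b) z) = a Re z + b Im z.\<close>
  have sum_coord: "(\<Sum>j<2 * k. t j * coord z j) =
      Re (\<Sum>i<k. Complex (t (2 * i)) (- t (2 * i + 1)) * z i)" for k t z
    by (induction k) (simp_all add: coord_def)
  have F_coord: "F (\<lambda>j\<in>{..<2 * m}. coord z j) = (\<lambda>i\<in>{..<m}. z i)" for z
    by (auto simp: F_def coord_def restrict_def fun_eq_iff complex_eq_iff)
  have mP [measurable]: "(\<lambda>x. coord (\<lambda>i. Z i x) j) \<in> borel_measurable P"
    and mQ [measurable]: "(\<lambda>x. coord (\<lambda>i. Z' i x) j) \<in> borel_measurable Q" if "j < 2 * m" for j
  proof -
    have "j div 2 < m" using that by auto
    then have [measurable]: "Z (j div 2) \<in> borel_measurable P" "Z' (j div 2) \<in> borel_measurable Q"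
      by auto
    show "(\<lambda>x. coord (\<lambda>i. Z i x) j) \<in> borel_measurable P" "(\<lambda>x. coord (\<lambda>i. Z' i x) j) \<in> borel_measurable Q"
      unfolding coord_def by (cases "even j"; simp)+
  qed
  have mF [measurable]: "F \<in> Pi\<^sub>M {..<2 * m} (\<lambda>_. borel) \<rightarrow>\<^sub>M Pi\<^sub>M {..<m} (\<lambda>_. borel)"
    unfolding F_def
  proof (rule measurable_restrict)
    fix i assume "i \<in> {..<m}"
    then have "2 * i < 2 * m" "2 * i + 1 < 2 * m" by auto
    then have [measurable]: "(\<lambda>y. y (2 * i)) \<in> borel_measurable (Pi\<^sub>M {..<2 * m} (\<lambda>_. borel :: real measure))"
      "(\<lambda>y. y (2 * i + 1)) \<in> borel_measurable (Pi\<^sub>M {..<2 * m} (\<lambda>_. borel :: real measure))"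
      by (auto intro!: measurable_component_singleton)
    show "(\<lambda>y. Complex (y (2 * i)) (y (2 * i + 1))) \<in> borel_measurable (Pi\<^sub>M {..<2 * m} (\<lambda>_. borel))"
      unfolding Complex_eq by measurable
  qed
  have [measurable]: "(\<lambda>x. \<lambda>j\<in>{..<2 * m}. coord (\<lambda>i. Z i x) j) \<in> P \<rightarrow>\<^sub>M Pi\<^sub>M {..<2 * m} (\<lambda>_. borel)"
    "(\<lambda>x. \<lambda>j\<in>{..<2 * m}. coord (\<lambda>i. Z' i x) j) \<in> Q \<rightarrow>\<^sub>M Pi\<^sub>M {..<2 * m} (\<lambda>_. borel)"
    using mP mQ by (auto intro!: measurable_restrict)
  have "distr P (Pi\<^sub>M {..<2 * m} (\<lambda>_. borel)) (\<lambda>x. \<lambda>j\<in>{..<2 * m}. coord (\<lambda>i. Z i x) j) =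
      distr Q (Pi\<^sub>M {..<2 * m} (\<lambda>_. borel)) (\<lambda>x. \<lambda>j\<in>{..<2 * m}. coord (\<lambda>i. Z' i x) j)"
    by (rule char_eq_imp_distr_eq) (use assms(1,2) mP mQ char in \<open>simp_all only: sum_coord\<close>)
  then have "distr (distr P (Pi\<^sub>M {..<2 * m} (\<lambda>_. borel)) (\<lambda>x. \<lambda>j\<in>{..<2 * m}. coord (\<lambda>i. Z i x) j))
        (Pi\<^sub>M {..<m} (\<lambda>_. borel)) F =
      distr (distr Q (Pi\<^sub>M {..<2 * m} (\<lambda>_. borel)) (\<lambda>x. \<lambda>j\<in>{..<2 * m}. coord (\<lambda>i. Z' i x) j))
        (Pi\<^sub>M {..<m} (\<lambda>_. borel)) F"
    by simp
  then show ?thesis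
    by (simp add: distr_distr comp_def F_coord)
qed

section \<open>Normal laws and independence from characteristic functions\<close>

lemma char_normal_distribution:
  assumes "0 < \<sigma>"
  shows "char (density lborel (normal_density 0 \<sigma>)) t = of_real (exp (- (\<sigma>\<^sup>2 * t\<^sup>2) / 2))"
proof -
  let ?N = "density lborel (normal_density 0 \<sigma>)"
  interpret N: prob_space ?N
    using assms by (rule prob_space_normal_density)
  have "distributed ?N lborel (\<lambda>x. x) (normal_density 0 \<sigma>)"
    by (auto simp: distributed_def distr_id2)
  then have "distributed ?N lborel (\<lambda>x. (x - 0) / \<sigma>) std_normal_density"
    using N.normal_standard_normal_convert[OF assms, of "\<lambda>x. x" 0] by blast
  then have "distr ?N lborel (\<lambda>x. x / \<sigma>) = std_normal_distribution"
    by (simp add: distributed_def)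
  \<comment> \<open>The notion \<open>distributed\<close> has target \<open>lborel\<close>,
    characteristic functions have target \<open>borel\<close>; both carry the same sets.\<close>
  moreover have "distr ?N lborel (\<lambda>x. x / \<sigma>) = distr ?N borel (\<lambda>x. x / \<sigma>)"
    by (rule distr_cong) simp_all
  ultimately have std: "distr ?N borel (\<lambda>x. x / \<sigma>) = std_normal_distribution"
    by simp
  \<comment> \<open>Rescaling to the standard normal law, with the factor \<sigma> moved into the
    argument.\<close>
  have "char ?N t = (\<integral>x. iexp ((t * \<sigma>) * (x / \<sigma>)) \<partial>?N)"
    unfolding char_def using assms by (intro Bochner_Integration.integral_cong) simp_all
  also have "\<dots> = char (distr ?N borel (\<lambda>x. x / \<sigma>)) (t * \<sigma>)"
    unfolding char_def by (rule integral_distr[symmetric]) simp_all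
  also have "\<dots> = of_real (exp (- (\<sigma>\<^sup>2 * t\<^sup>2) / 2))"
    by (simp add: std char_std_normal_distribution power_mult_distrib mult.commute)
  finally show ?thesis .
qed

text \<open>Uniqueness against the centred normal law of variance v, or against the point mass at 0
  when v = 0. The degenerate case does occur, for instance for f = 0.\<close>

lemma gaussian_rvI_char:
  assumes "prob_space M" and [measurable]: "Y \<in> borel_measurable M" and "0 \<le> v"
    and char: "\<And>t. (\<integral>\<omega>. iexp (t * Y \<omega>) \<partial>M) = of_real (exp (- (v * t\<^sup>2) / 2))"
  shows "gaussian_rv M Y"
proof -
  interpret prob_space M by fact
  have dist: "real_distribution (distr M borel Y)"
    by (rule real_distribution_distr) simp
  have char_Y: "char (distr M borel Y) t = of_real (exp (- (v * t\<^sup>2) / 2))" for t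
    using char[of t] by (simp add: char_def integral_distr)
  show ?thesis
  proof (cases "v = 0")
    case True
    have "real_distribution (return borel (0 :: real))"
      by (simp add: real_distribution_def real_distribution_axioms_def prob_space_return)
    moreover have "char (return borel 0) t = 1" for t :: real
      by (simp add: char_def integral_return)
    ultimately have "distr M borel Y = return borel 0"
      by (intro Levy_uniqueness[OF dist] ext) (simp_all add: char_Y True)
    then show ?thesis by (auto simp: gaussian_rv_def)
  next
    case False
    then have "0 < sqrt v" using \<open>0 \<le> v\<close> by simp
    moreover from this have "real_distribution (density lborel (normal_density 0 (sqrt v)))"
      by (simp add: real_distribution_def real_distribution_axioms_def prob_space_normal_density)
    ultimately have "distr M borel Y = density lborel (normal_density 0 (sqrt v))"
      using \<open>0 \<le> v\<close> by (intro Levy_uniqueness[OF dist] ext) (simp_all add: char_Y char_normal_distribution)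
    then have "\<exists>\<sigma>>0. distr M borel Y = density lborel (normal_density 0 \<sigma>)"
      using \<open>0 < sqrt v\<close> by blast
    then show ?thesis unfolding gaussian_rv_def using assms(2) by blast
  qed
qed

text \<open>The factorisation says that (Y, Z) has the characteristic function of the product of the
  two laws. Uniqueness in dimension 2 makes the joint law equal to that product, which is
  independence.\<close>

lemma (in prob_space) indep_varI_char:
  fixes Y Z :: "'a \<Rightarrow> real"
  assumes [measurable]: "Y \<in> borel_measurable M" "Z \<in> borel_measurable M"
    and char: "\<And>a b. (\<integral>x. iexp (a * Y x + b * Z x) \<partial>M) = (\<integral>x. iexp (a * Y x) \<partial>M) * (\<integral>x. iexp (b * Z x) \<partial>M)"
  shows "indep_var borel Y borel Z"
proof -
  let ?Y = "distr M borel Y" and ?Z = "distr M borel Z"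
  let ?Q = "?Y \<Otimes>\<^sub>M ?Z"
  interpret Y: prob_space ?Y by (rule prob_space_distr) measurable
  interpret Z: prob_space ?Z by (rule prob_space_distr) measurable
  interpret Q: pair_prob_space ?Y ?Z ..
  \<comment> \<open>Uniqueness is available for vectors indexed by {..<2}; this map converts them to
    pairs.\<close>
  define F :: "(nat \<Rightarrow> real) \<Rightarrow> real \<times> real" where "F y = (y 0, y 1)" for y
  have [measurable]: "F \<in> Pi\<^sub>M {..<2} (\<lambda>_. borel) \<rightarrow>\<^sub>M borel \<Otimes>\<^sub>M borel"
    unfolding F_def by (intro measurable_Pair measurable_component_singleton) auto
  let ?V = "\<lambda>i x. if i = (0::nat) then Y x else Z x" and ?W = "\<lambda>i p. if i = (0::nat) then fst p else snd p"
  have mV [measurable]: "(\<lambda>x. \<lambda>i\<in>{..<2}. ?V i x) \<in> M \<rightarrow>\<^sub>M Pi\<^sub>M {..<2} (\<lambda>_. borel)"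
    and mW [measurable]: "(\<lambda>p. \<lambda>i\<in>{..<2}. ?W i p) \<in> ?Q \<rightarrow>\<^sub>M Pi\<^sub>M {..<2} (\<lambda>_. borel)"
    by (intro measurable_restrict; simp)+
  have "distr M (Pi\<^sub>M {..<2} (\<lambda>_. borel)) (\<lambda>x. \<lambda>i\<in>{..<2}. ?V i x) =
      distr ?Q (Pi\<^sub>M {..<2} (\<lambda>_. borel)) (\<lambda>p. \<lambda>i\<in>{..<2}. ?W i p)"
  proof (rule char_eq_imp_distr_eq)
    fix t :: "nat \<Rightarrow> real"
    have "integrable ?Q (\<lambda>p. iexp (t 0 * fst p + t 1 * snd p))"
      by (rule Q.integrable_iexp_real) measurable
    then have "(\<integral>p. iexp (t 0 * fst p + t 1 * snd p) \<partial>?Q) = (\<integral>y. (\<integral>z. iexp (t 0 * y + t 1 * z) \<partial>?Z) \<partial>?Y)"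
      using Q.integral_fst'[symmetric] by force
    also have "\<dots> = (\<integral>y. iexp (t 0 * y) \<partial>?Y) * (\<integral>z. iexp (t 1 * z) \<partial>?Z)"
      by (simp add: distrib_left exp_add)
    also have "\<dots> = (\<integral>x. iexp (t 0 * Y x + t 1 * Z x) \<partial>M)"
      unfolding char by (simp add: integral_distr)
    finally show "(\<integral>x. iexp (\<Sum>i<2. t i * ?V i x) \<partial>M) = (\<integral>p. iexp (\<Sum>i<2. t i * ?W i p) \<partial>?Q)"
      by (simp add: numeral_2_eq_2)
  qed (simp_all add: finite_measure_axioms Q.finite_measure_axioms)
  then have "distr (distr M (Pi\<^sub>M {..<2} (\<lambda>_. borel)) (\<lambda>x. \<lambda>i\<in>{..<2}. ?V i x)) (borel \<Otimes>\<^sub>M borel) F =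
      distr (distr ?Q (Pi\<^sub>M {..<2} (\<lambda>_. borel)) (\<lambda>p. \<lambda>i\<in>{..<2}. ?W i p)) (borel \<Otimes>\<^sub>M borel) F"
    by simp
  then have "distr M (borel \<Otimes>\<^sub>M borel) (\<lambda>x. (Y x, Z x)) = distr ?Q (borel \<Otimes>\<^sub>M borel) (\<lambda>p. p)"
    by (simp add: distr_distr comp_def F_def)
  also have "\<dots> = ?Q"
    by (intro distr_id2 sets_pair_measure_cong) simp_all
  finally show ?thesis
    by (simp add: indep_var_distribution_eq)
qed

section \<open>The rotation group\<close>

lemma SO3_mult: "g \<in> SO3 \<Longrightarrow> h \<in> SO3 \<Longrightarrow> g ** h \<in> SO3"
  by (simp add: SO3_def rotation_matrix_def orthogonal_matrix_mul det_mul)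

lemma SO3_mat_1: "mat 1 \<in> SO3"
  by (simp add: SO3_def rotation_matrix_def orthogonal_matrix_id)

lemma SO3_transpose: "g \<in> SO3 \<Longrightarrow> transpose g \<in> SO3"
  by (simp add: SO3_def rotation_matrix_def)

text \<open>\<open>matrix_inv\<close> is a choice, for which the transpose is a witness; multiplying
  by \<open>g ** transpose g\<close> identifies the two. With the transpose in its place, inversion
  is visibly continuous and hence measurable.\<close>

lemma SO3_matrix_inv: "g \<in> SO3 \<Longrightarrow> matrix_inv g = transpose g"
proof -
  assume "g \<in> SO3"
  then have g: "g ** transpose g = mat 1" "transpose g ** g = mat 1"
    by (simp_all add: SO3_def rotation_matrix_def orthogonal_matrix_def)
  then have inv: "matrix_inv g ** g = mat 1"
    unfolding matrix_inv_def by (rule_tac someI2[of _ "transpose g"]) auto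
  have "matrix_inv g = matrix_inv g ** (g ** transpose g)"
    using g by simp
  also have "\<dots> = transpose g"
    using inv by (simp add: matrix_mul_assoc)
  finally show ?thesis .
qed

lemma SO3_matrix_inv_closed: "g \<in> SO3 \<Longrightarrow> matrix_inv g \<in> SO3"
  by (simp add: SO3_matrix_inv SO3_transpose)

lemma SO3_inverse_left: "g \<in> SO3 \<Longrightarrow> matrix_inv g ** g = mat 1"
  by (simp add: SO3_matrix_inv) (simp add: SO3_def rotation_matrix_def orthogonal_matrix_def)

lemma SO3_matrix_inv_mult: "g \<in> SO3 \<Longrightarrow> h \<in> SO3 \<Longrightarrow> matrix_inv (g ** h) = matrix_inv h ** matrix_inv g"
  by (simp add: SO3_matrix_inv SO3_mult matrix_transpose_mul)

lemma SO3_matrix_inv_matrix_inv: "g \<in> SO3 \<Longrightarrow> matrix_inv (matrix_inv g) = g"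
  by (simp add: SO3_matrix_inv SO3_transpose)

section \<open>The isotropy group and its characters\<close>

lemma K_north_SO3: "k \<in> K_north \<Longrightarrow> k \<in> SO3"
  by (simp add: K_north_def)

lemma K_north_mat_1: "mat 1 \<in> K_north"
  by (simp add: K_north_def SO3_mat_1)

lemma K_north_matrix_inv:
  assumes "k \<in> K_north"
  shows "matrix_inv k \<in> K_north"
proof -
  have "matrix_inv k *v north_pole = matrix_inv k *v (k *v north_pole)"
    using assms by (simp add: K_north_def)
  also have "\<dots> = north_pole"
    using SO3_inverse_left[OF K_north_SO3[OF assms]] by (simp add: matrix_vector_mul_assoc)
  finally show ?thesis
    using assms by (simp add: K_north_def SO3_matrix_inv_closed)
qed

lemma zrot_K_north: "zrot t \<in> K_north"
proof -
  have "transpose (zrot t) ** zrot t = mat 1"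
    by (simp add: zrot_def vec_eq_iff forall_3 matrix_matrix_mult_def transpose_def sum_3 mat_def
        power2_eq_square[symmetric] algebra_simps)
  moreover have "det (zrot t) = 1"
    by (simp add: zrot_def det_3 power2_eq_square[symmetric])
  moreover have "zrot t *v north_pole = north_pole"
    by (simp add: zrot_def north_pole_def vec_eq_iff forall_3 matrix_vector_mult_def sum_3 axis_def)
  ultimately show ?thesis
    by (simp add: K_north_def SO3_def rotation_matrix_def orthogonal_matrix)
qed

lemma zrot_0: "zrot 0 = mat 1"
  by (simp add: zrot_def vec_eq_iff forall_3 mat_def)

lemma rot_angle_zrot:
  assumes "0 \<le> t" "t < 2 * pi"
  shows "rot_angle (zrot t) = t"
  unfolding rot_angle_def
proof (rule the_equality)
  fix u assume u: "0 \<le> u \<and> u < 2 * pi \<and> zrot t = zrot u"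
  then have "(zrot t) $ 1 $ 1 = (zrot u) $ 1 $ 1" "(zrot t) $ 2 $ 1 = (zrot u) $ 2 $ 1"
    by simp_all
  then have "cos t = cos u" "sin t = sin u"
    by (simp_all add: zrot_def)
  then obtain n :: int where n: "t = u + 2 * pi * of_int n"
    using sin_cos_eq_iff[of t u] by auto
  \<comment> \<open>Two points of the half-open interval from 0 to 2 pi differ by less than a full
    period.\<close>
  have "n = 0"
  proof (rule ccontr)
    assume "n \<noteq> 0"
    then consider "n \<ge> 1" | "n \<le> -1" by linarith
    then show False
    proof cases
      case 1
      then have "2 * pi * 1 \<le> 2 * pi * of_int n" by (intro mult_left_mono) auto
      then show False using n u assms by linarith
    next
      case 2
      then have "2 * pi * of_int n \<le> 2 * pi * of_int (-1)" by (intro mult_left_mono) (simp_all only: of_int_le_iff, simp)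
      then show False using n u assms by simp
    qed
  qed
  then show "u = t" using n by simp
qed (use assms in auto)

lemma chi_zrot:
  assumes "0 \<le> t" "t < 2 * pi"
  shows "chi s (zrot t) = exp (\<i> * of_int s * of_real t)"
  using assms by (simp add: chi_def rot_angle_zrot)

lemma chi_mat_1: "chi s (mat 1) = 1"
  using chi_zrot[of 0 s] by (simp add: zrot_0)

lemma chi_power2_eq_minus_1:
  assumes "s \<noteq> 0"
  obtains k where "k \<in> K_north" "(chi s k)\<^sup>2 = -1"
proof
  \<comment> \<open>The angle satisfies 2 s t = pi or 2 s t = - pi, and both give -1. The absolute
    value keeps it nonnegative, in the range where \<open>rot_angle\<close> is known.\<close>
  let ?t = "pi / (2 * \<bar>of_int s\<bar>)"
  have s: "1 \<le> \<bar>of_int s :: real\<bar>" using assms by linarith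
  then have "?t \<le> pi / 2" by (intro divide_left_mono) auto
  then have "?t < 2 * pi" using pi_gt_zero by linarith
  moreover have "0 \<le> ?t" by simp
  ultimately have "chi s (zrot ?t) = exp (\<i> * of_int s * of_real ?t)"
    by (intro chi_zrot)
  then have "(chi s (zrot ?t))\<^sup>2 = exp (2 * (\<i> * of_int s * of_real ?t))"
    by (simp only: exp_double)
  also have "2 * (\<i> * of_int s * of_real ?t) = \<i> * of_real (sgn (of_int s) * pi)"
    using assms by (cases "s > 0") (simp_all add: field_simps)
  also have "exp \<dots> = cis (sgn (of_int s) * pi)"
    by (simp add: cis_conv_exp)
  also have "\<dots> = -1"
    using assms by (cases "s > 0") (simp_all add: complex_eq_iff)
  finally show "(chi s (zrot ?t))\<^sup>2 = -1" .
qed (rule zrot_K_north)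

section \<open>Haar measure\<close>

locale haar_SO3 =
  fixes \<mu> :: "mat3 measure"
  assumes haar: "normalized_haar \<mu>"
begin

sublocale prob_space \<mu>
  using haar by (simp add: normalized_haar_def)

lemma sets_haar: "sets \<mu> = sets (restrict_space borel SO3)"
  using haar by (simp add: normalized_haar_def)

lemma space_haar: "space \<mu> = SO3"
  using sets_eq_imp_space_eq[OF sets_haar] by (simp add: space_restrict_space)

lemma distr_left: "g \<in> SO3 \<Longrightarrow> distr \<mu> \<mu> (\<lambda>h. g ** h) = \<mu>"
  using haar by (simp add: normalized_haar_def)

lemma measurable_haar_borel: "(\<lambda>x. x) \<in> \<mu> \<rightarrow>\<^sub>M borel"
  unfolding measurable_cong_sets[OF sets_haar refl] by (simp add: measurable_restrict_space1)

text \<open>The sigma-algebra of \<mu> is the trace of the Borel sets of the matrix space, so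
  continuity on all matrices plus closure of \<open>SO3\<close> gives measurability of the group
  operations.\<close>

lemma measurable_into_haar:
  assumes "F \<in> N \<rightarrow>\<^sub>M borel" "\<And>x. x \<in> space N \<Longrightarrow> F x \<in> SO3"
  shows "F \<in> N \<rightarrow>\<^sub>M \<mu>"
  unfolding measurable_cong_sets[OF refl sets_haar]
  using assms by (intro measurable_restrict_space2) auto

lemma measurable_mult [measurable (raw)]:
  assumes "F \<in> N \<rightarrow>\<^sub>M \<mu>" "G \<in> N \<rightarrow>\<^sub>M \<mu>"
  shows "(\<lambda>x. F x ** G x) \<in> N \<rightarrow>\<^sub>M \<mu>"
proof (rule measurable_into_haar)
  have "continuous_on UNIV (\<lambda>p :: mat3 \<times> mat3. fst p ** snd p)"
    unfolding matrix_matrix_mult_def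
    by (intro continuous_on_vec_lambda continuous_intros)
  then have "(\<lambda>p :: mat3 \<times> mat3. fst p ** snd p) \<in> borel_measurable (borel \<Otimes>\<^sub>M borel)"
    unfolding borel_prod by (rule borel_measurable_continuous_onI)
  moreover have "(\<lambda>x. (F x, G x)) \<in> N \<rightarrow>\<^sub>M borel \<Otimes>\<^sub>M borel"
    using measurable_compose[OF assms(1) measurable_haar_borel] measurable_compose[OF assms(2) measurable_haar_borel]
    by simp
  ultimately show "(\<lambda>x. F x ** G x) \<in> borel_measurable N"
    using measurable_compose[of "\<lambda>x. (F x, G x)" N "borel \<Otimes>\<^sub>M borel" "\<lambda>p. fst p ** snd p" borel] by simp
  show "F x ** G x \<in> SO3" if "x \<in> space N" for x
    using measurable_space[OF assms(1) that] measurable_space[OF assms(2) that]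
    by (simp add: space_haar SO3_mult)
qed

lemma measurable_inv [measurable (raw)]:
  assumes "F \<in> N \<rightarrow>\<^sub>M \<mu>"
  shows "(\<lambda>x. matrix_inv (F x)) \<in> N \<rightarrow>\<^sub>M \<mu>"
proof (rule measurable_into_haar)
  have "continuous_on UNIV (transpose :: mat3 \<Rightarrow> mat3)"
    unfolding transpose_def by (intro continuous_on_vec_lambda continuous_intros)
  then have "transpose \<in> borel_measurable (borel :: mat3 measure)"
    by (rule borel_measurable_continuous_onI)
  then have "(\<lambda>x. transpose (F x)) \<in> borel_measurable N"
    using measurable_compose[OF measurable_compose[OF assms measurable_haar_borel]] by blast
  moreover have F: "F x \<in> SO3" if "x \<in> space N" for x
    using measurable_space[OF assms that] by (simp add: space_haar)
  ultimately show "(\<lambda>x. matrix_inv (F x)) \<in> borel_measurable N"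
    by (subst measurable_cong[where g = "\<lambda>x. transpose (F x)"]) (simp_all add: SO3_matrix_inv)
  show "matrix_inv (F x) \<in> SO3" if "x \<in> space N" for x
    using F[OF that] by (rule SO3_matrix_inv_closed)
qed

lemma SO3_measurable_const [measurable]: "g \<in> SO3 \<Longrightarrow> (\<lambda>_. g) \<in> N \<rightarrow>\<^sub>M \<mu>"
  by (simp add: space_haar)

lemma measurable_left [measurable]: "g \<in> SO3 \<Longrightarrow> (\<lambda>x. g ** x) \<in> \<mu> \<rightarrow>\<^sub>M \<mu>"
  by (intro measurable_mult SO3_measurable_const) simp_all

lemma measurable_right [measurable]: "g \<in> SO3 \<Longrightarrow> (\<lambda>x. x ** g) \<in> \<mu> \<rightarrow>\<^sub>M \<mu>"
  by (intro measurable_mult SO3_measurable_const) simp_all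

lemma nn_integral_left:
  assumes "g \<in> SO3" and [measurable]: "F \<in> borel_measurable \<mu>"
  shows "(\<integral>\<^sup>+x. F (g ** x) \<partial>\<mu>) = (\<integral>\<^sup>+x. F x \<partial>\<mu>)"
  using nn_integral_distr[OF measurable_left[OF assms(1)], of F] assms by (simp add: distr_left)

lemma integral_left:
  fixes F :: "mat3 \<Rightarrow> 'b::{banach, second_countable_topology}"
  assumes "g \<in> SO3" "F \<in> borel_measurable \<mu>"
  shows "(\<integral>x. F (g ** x) \<partial>\<mu>) = (\<integral>x. F x \<partial>\<mu>)"
  using integral_distr[OF measurable_left[OF assms(1)] assms(2)] assms(1) by (simp add: distr_left)

lemma integrable_left:
  fixes F :: "mat3 \<Rightarrow> 'b::{banach, second_countable_topology}"
  assumes "g \<in> SO3" "integrable \<mu> F"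
  shows "integrable \<mu> (\<lambda>x. F (g ** x))"
  using integrable_distr[OF measurable_left[OF assms(1)], of F] assms by (simp add: distr_left)

lemma in_L2_left:
  assumes "in_L2 \<mu> \<phi>" "g \<in> SO3"
  shows "in_L2 \<mu> (\<lambda>x. \<phi> (g ** x))"
  using assms integrable_left[OF assms(2) in_L2_integrable_power2[OF assms(1)]]
    measurable_compose[OF measurable_left[OF assms(2)] in_L2_measurable[OF assms(1)]]
  by (simp add: in_L2_def)

lemma in_L2_translate: "in_L2 \<mu> \<phi> \<Longrightarrow> g \<in> SO3 \<Longrightarrow> in_L2 \<mu> (translate g \<phi>)"
  unfolding translate_def by (intro in_L2_left SO3_matrix_inv_closed)

text \<open>Averaging \<open>F (x\<^sup>-\<^sup>1 y)\<close> over \<open>x\<close> and \<open>y\<close> in both orders shows that every invariant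
  probability measure is the image of \<open>\<mu>\<close> under inversion; hence \<open>\<mu>\<close> is unique.\<close>

lemma nn_integral_haar_inverse:
  assumes \<nu>: "normalized_haar \<nu>" and F: "F \<in> borel_measurable \<mu>"
  shows "(\<integral>\<^sup>+y. F y \<partial>\<nu>) = (\<integral>\<^sup>+x. F (matrix_inv x) \<partial>\<mu>)"
proof -
  interpret \<nu>: haar_SO3 \<nu> by standard (rule \<nu>)
  interpret P: pair_sigma_finite \<mu> \<nu> ..
  note [measurable] = F
  have sets_eq: "sets \<nu> = sets \<mu>"
    by (simp add: sets_haar \<nu>.sets_haar)
  have [measurable]: "F \<in> borel_measurable \<nu>"
    using F by (simp add: measurable_cong_sets[OF sets_eq refl])
  have snd: "snd \<in> \<mu> \<Otimes>\<^sub>M \<nu> \<rightarrow>\<^sub>M \<mu>"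
    using measurable_snd[of \<mu> \<nu>] by (simp add: measurable_cong_sets[OF refl sets_eq])
  have meas: "(\<lambda>(x, y). F (matrix_inv x ** y)) \<in> borel_measurable (\<mu> \<Otimes>\<^sub>M \<nu>)"
    unfolding split_beta' by (intro measurable_compose[OF _ F] measurable_mult measurable_inv measurable_fst snd)
  have "(\<integral>\<^sup>+y. F y \<partial>\<nu>) = (\<integral>\<^sup>+x. (\<integral>\<^sup>+y. F y \<partial>\<nu>) \<partial>\<mu>)"
    by (simp add: emeasure_space_1)
  also have "\<dots> = (\<integral>\<^sup>+x. (\<integral>\<^sup>+y. F (matrix_inv x ** y) \<partial>\<nu>) \<partial>\<mu>)"
    by (intro nn_integral_cong \<nu>.nn_integral_left[symmetric]) (simp_all add: space_haar SO3_matrix_inv_closed)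
  also have "\<dots> = (\<integral>\<^sup>+y. (\<integral>\<^sup>+x. F (matrix_inv x ** y) \<partial>\<mu>) \<partial>\<nu>)"
    using P.Fubini'[OF meas] by simp
  also have "\<dots> = (\<integral>\<^sup>+y. (\<integral>\<^sup>+x. F (matrix_inv x) \<partial>\<mu>) \<partial>\<nu>)"
  proof (rule nn_integral_cong)
    fix y assume "y \<in> space \<nu>"
    then have y: "y \<in> SO3" by (simp add: \<nu>.space_haar)
    \<comment> \<open>The element x^-1 y is the inverse of y^-1 x, so left invariance of \<mu>
      removes y.\<close>
    have "(\<integral>\<^sup>+x. F (matrix_inv x ** y) \<partial>\<mu>) = (\<integral>\<^sup>+x. F (matrix_inv (matrix_inv y ** x)) \<partial>\<mu>)"
      using y by (intro nn_integral_cong)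
        (simp add: space_haar SO3_matrix_inv_mult SO3_matrix_inv_closed SO3_matrix_inv_matrix_inv)
    also have "\<dots> = (\<integral>\<^sup>+x. F (matrix_inv x) \<partial>\<mu>)"
      using y by (intro nn_integral_left[where F = "\<lambda>x. F (matrix_inv x)"] SO3_matrix_inv_closed) measurable
    finally show "(\<integral>\<^sup>+x. F (matrix_inv x ** y) \<partial>\<mu>) = (\<integral>\<^sup>+x. F (matrix_inv x) \<partial>\<mu>)" .
  qed
  also have "\<dots> = (\<integral>\<^sup>+x. F (matrix_inv x) \<partial>\<mu>)"
    by (simp add: \<nu>.emeasure_space_1)
  finally show ?thesis .
qed

text \<open>The right-hand side of \<open>nn_integral_haar_inverse\<close> is free of \<nu>; it is
  used once for \<nu> and once for \<mu> itself.\<close>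

lemma haar_unique:
  assumes "normalized_haar \<nu>"
  shows "\<nu> = \<mu>"
proof (rule measure_eqI)
  interpret \<nu>: haar_SO3 \<nu> by standard (rule assms)
  show eq: "sets \<nu> = sets \<mu>"
    by (simp add: sets_haar \<nu>.sets_haar)
  fix A assume "A \<in> sets \<nu>"
  then have [measurable]: "A \<in> sets \<mu>" by (simp add: eq)
  show "emeasure \<nu> A = emeasure \<mu> A"
    using nn_integral_haar_inverse[OF assms, of "indicator A"] nn_integral_haar_inverse[OF haar, of "indicator A"]
      \<open>A \<in> sets \<nu>\<close> by simp
qed

text \<open>Left and right translations commute, so the image of \<mu> under a right translation is
  again a left invariant probability measure; by uniqueness it is \<mu>.\<close>

lemma distr_right:
  assumes k: "k \<in> SO3"
  shows "distr \<mu> \<mu> (\<lambda>x. x ** k) = \<mu>"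
proof (rule haar_unique)
  note [measurable] = measurable_right[OF k]
  have "distr (distr \<mu> \<mu> (\<lambda>x. x ** k)) (distr \<mu> \<mu> (\<lambda>x. x ** k)) (\<lambda>h. g ** h) = distr \<mu> \<mu> (\<lambda>x. x ** k)"
    if g: "g \<in> SO3" for g
  proof -
    note [measurable] = measurable_left[OF g]
    have "distr (distr \<mu> \<mu> (\<lambda>x. x ** k)) (distr \<mu> \<mu> (\<lambda>x. x ** k)) (\<lambda>h. g ** h) =
        distr (distr \<mu> \<mu> (\<lambda>x. x ** k)) \<mu> (\<lambda>h. g ** h)"
      by (rule distr_cong) auto
    also have "\<dots> = distr \<mu> \<mu> (\<lambda>x. (g ** x) ** k)"
      by (simp add: distr_distr comp_def matrix_mul_assoc)
    also have "\<dots> = distr (distr \<mu> \<mu> (\<lambda>x. g ** x)) \<mu> (\<lambda>x. x ** k)"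
      by (subst distr_distr) (simp_all add: comp_def)
    also have "\<dots> = distr \<mu> \<mu> (\<lambda>x. x ** k)"
      by (simp add: distr_left g)
    finally show ?thesis .
  qed
  then show "normalized_haar (distr \<mu> \<mu> (\<lambda>x. x ** k))"
    by (auto simp: normalized_haar_def sets_haar intro: prob_space_distr measurable_right[OF k])
qed

lemma integral_right:
  fixes F :: "mat3 \<Rightarrow> 'b::{banach, second_countable_topology}"
  assumes "k \<in> SO3" "F \<in> borel_measurable \<mu>"
  shows "(\<integral>x. F (x ** k) \<partial>\<mu>) = (\<integral>x. F x \<partial>\<mu>)"
  using integral_distr[OF measurable_right[OF assms(1)] assms(2)] assms(1) by (simp add: distr_right)

end

section \<open>Square integrable kernels\<close>

context pair_sigma_finite
begin

lemma in_L2_pairI: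
  assumes [measurable]: "F \<in> borel_measurable (M1 \<Otimes>\<^sub>M M2)"
    and slice: "\<And>x. x \<in> space M1 \<Longrightarrow> in_L2 M2 (\<lambda>y. F (x, y))"
    and int: "integrable M1 (\<lambda>x. \<integral>y. (cmod (F (x, y)))\<^sup>2 \<partial>M2)"
  shows "in_L2 (M1 \<Otimes>\<^sub>M M2) F"
  unfolding in_L2_def
proof (intro conjI Fubini_integrable)
  show "integrable M1 (\<lambda>x. \<integral>y. norm ((cmod (F (x, y)))\<^sup>2) \<partial>M2)"
    using int by simp
  show "AE x in M1. integrable M2 (\<lambda>y. (cmod (F (x, y)))\<^sup>2)"
    using slice by (intro AE_I2 in_L2_integrable_power2)
qed measurable

lemma in_L2_AE_slice:
  assumes "in_L2 (M1 \<Otimes>\<^sub>M M2) F"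
  shows "AE y in M2. in_L2 M1 (\<lambda>x. F (x, y))"
proof -
  note [measurable] = in_L2_measurable[OF assms]
  have "integrable (M1 \<Otimes>\<^sub>M M2) (\<lambda>(x, y). (cmod (F (x, y)))\<^sup>2)"
    using in_L2_integrable_power2[OF assms] by (simp add: case_prod_beta')
  from AE_integrable_snd[OF this] AE_space show ?thesis
    by eventually_elim (simp add: in_L2_def)
qed

text \<open>Cauchy-Schwarz on almost every slice, integrated over the second variable. The first
  claim makes smearing well defined in L2, the second makes it continuous in the kernel, as is
  needed for remainders tending to 0.\<close>

lemma
  assumes F: "in_L2 (M1 \<Otimes>\<^sub>M M2) F" and h: "in_L2 M1 h"
  shows in_L2_smear: "in_L2 M2 (\<lambda>y. \<integral>x. F (x, y) * h x \<partial>M1)"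
    and L2_smear_le: "(\<integral>y. (cmod (\<integral>x. F (x, y) * h x \<partial>M1))\<^sup>2 \<partial>M2) \<le>
      (\<integral>p. (cmod (F p))\<^sup>2 \<partial>(M1 \<Otimes>\<^sub>M M2)) * (\<integral>x. (cmod (h x))\<^sup>2 \<partial>M1)"
proof -
  note [measurable] = in_L2_measurable[OF F] in_L2_measurable[OF h]
  let ?H = "\<integral>x. (cmod (h x))\<^sup>2 \<partial>M1"
  let ?w = "\<lambda>y. (\<integral>x. (cmod (F (x, y)))\<^sup>2 \<partial>M1) * ?H"
  have int: "integrable (M1 \<Otimes>\<^sub>M M2) (\<lambda>(x, y). (cmod (F (x, y)))\<^sup>2)"
    using in_L2_integrable_power2[OF F] by (simp add: case_prod_beta')
  have w: "integrable M2 ?w"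
    using integrable_snd[OF int] by simp
  have meas: "(\<lambda>y. \<integral>x. F (x, y) * h x \<partial>M1) \<in> borel_measurable M2"
    by measurable
  have le: "AE y in M2. (cmod (\<integral>x. F (x, y) * h x \<partial>M1))\<^sup>2 \<le> ?w y"
    using in_L2_AE_slice[OF F] by eventually_elim (rule L2_Cauchy_Schwarz[OF _ h])
  show L2: "in_L2 M2 (\<lambda>y. \<integral>x. F (x, y) * h x \<partial>M1)"
    by (rule in_L2_bounded_by[OF meas w le])
  have "(\<integral>y. (cmod (\<integral>x. F (x, y) * h x \<partial>M1))\<^sup>2 \<partial>M2) \<le> (\<integral>y. ?w y \<partial>M2)"
    by (rule integral_mono_AE[OF in_L2_integrable_power2[OF L2] w le])
  also have "\<dots> = (\<integral>p. (cmod (F p))\<^sup>2 \<partial>(M1 \<Otimes>\<^sub>M M2)) * ?H"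
    using integral_snd[OF int] by (simp add: case_prod_beta')
  finally show "(\<integral>y. (cmod (\<integral>x. F (x, y) * h x \<partial>M1))\<^sup>2 \<partial>M2) \<le>
      (\<integral>p. (cmod (F p))\<^sup>2 \<partial>(M1 \<Otimes>\<^sub>M M2)) * ?H" .
qed

lemma in_L2_tensor:
  assumes h: "in_L2 M1 h" and k: "in_L2 M2 k"
  shows "in_L2 (M1 \<Otimes>\<^sub>M M2) (\<lambda>p. h (fst p) * k (snd p))"
proof (rule in_L2_pairI)
  note [measurable] = in_L2_measurable[OF h] in_L2_measurable[OF k]
  show "(\<lambda>p. h (fst p) * k (snd p)) \<in> borel_measurable (M1 \<Otimes>\<^sub>M M2)"
    by measurable
  show "integrable M1 (\<lambda>x. \<integral>y. (cmod (h (fst (x, y)) * k (snd (x, y))))\<^sup>2 \<partial>M2)"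
    using in_L2_integrable_power2[OF h] by (simp add: norm_mult power_mult_distrib)
qed (simp add: in_L2_cmult k)

end

section \<open>Parseval's identity for a real orthonormal basis\<close>

locale haar_basis = haar_SO3 +
  fixes e :: "nat \<Rightarrow> mat3 \<Rightarrow> real"
  assumes basis: "real_orthonormal_basis \<mu> e"
begin

lemma in_L2_basis: "in_L2 \<mu> (\<lambda>x. complex_of_real (e k x))"
  using basis by (simp add: real_orthonormal_basis_def)

lemma orthonormal: "(\<integral>x. e j x * e k x \<partial>\<mu>) = (if j = k then 1 else 0)"
  using basis by (simp add: real_orthonormal_basis_def)

lemma basis_dense:
  assumes "in_L2 \<mu> \<phi>" "\<epsilon> > 0"
  obtains n c where "(\<integral>x. (cmod (\<phi> x - (\<Sum>k<n. c k * of_real (e k x))))\<^sup>2 \<partial>\<mu>) < \<epsilon>"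
  using basis assms unfolding real_orthonormal_basis_def by blast

lemma fourier_coeff_cmult: "fourier_coeff \<mu> e (\<lambda>x. a * \<phi> x) k = a * fourier_coeff \<mu> e \<phi> k"
  by (simp add: fourier_coeff_def mult.assoc)

lemma fourier_coeff_sum:
  assumes "\<And>i. i \<in> A \<Longrightarrow> in_L2 \<mu> (\<phi> i)"
  shows "fourier_coeff \<mu> e (\<lambda>x. \<Sum>i\<in>A. \<phi> i x) k = (\<Sum>i\<in>A. fourier_coeff \<mu> e (\<phi> i) k)"
  unfolding fourier_coeff_def sum_distrib_right
  by (intro Bochner_Integration.integral_sum in_L2_integrable_mult in_L2_basis assms)

text \<open>Since the basis is real, the real parts of the coefficients are the coefficients of the
  real part. Bessel's inequality bounds the partial sums from above, and density of the span shows
  that they reach the bound.\<close>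

lemma parseval_Re:
  assumes "in_L2 \<mu> \<phi>"
  shows "(\<lambda>k. (Re (fourier_coeff \<mu> e \<phi> k))\<^sup>2) sums (\<integral>x. (Re (\<phi> x))\<^sup>2 \<partial>\<mu>)"
proof -
  define \<rho> where "\<rho> x = Re (\<phi> x)" for x
  define a where "a k = Re (fourier_coeff \<mu> e \<phi> k)" for k
  define R where "R = (\<integral>x. (\<rho> x)\<^sup>2 \<partial>\<mu>)"
  define s where "s n = (\<Sum>k<n. (a k)\<^sup>2)" for n
  have \<rho>: "in_L2 \<mu> (\<lambda>x. complex_of_real (\<rho> x))"
    unfolding \<rho>_def by (rule in_L2_of_real_Re[OF assms])
  have int_\<rho>: "integrable \<mu> (\<lambda>x. (\<rho> x)\<^sup>2)"
    using in_L2_integrable_power2[OF \<rho>] by simp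
  have int_\<rho>e: "integrable \<mu> (\<lambda>x. \<rho> x * e k x)" for k
    using integrable_Re[OF in_L2_integrable_mult[OF \<rho> in_L2_basis[of k]]] by simp
  have int_ee: "integrable \<mu> (\<lambda>x. e j x * e k x)" for j k
    using integrable_Re[OF in_L2_integrable_mult[OF in_L2_basis[of j] in_L2_basis[of k]]] by simp
  have a: "(\<integral>x. \<rho> x * e k x \<partial>\<mu>) = a k" for k
    using integral_Re[OF in_L2_integrable_mult[OF assms in_L2_basis[of k]]]
    by (simp add: a_def fourier_coeff_def \<rho>_def)
  \<comment> \<open>Completing the square: the distance to a combination with coefficients b is
    least for b = a. The case b = a is Bessel's inequality.\<close>
  have expand: "(\<integral>x. (\<rho> x - (\<Sum>k<n. b k * e k x))\<^sup>2 \<partial>\<mu>) = R - s n + (\<Sum>k<n. (b k - a k)\<^sup>2)" for b n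
  proof -
    have "(\<rho> x - (\<Sum>k<n. b k * e k x))\<^sup>2 =
        (\<rho> x)\<^sup>2 - 2 * (\<Sum>k<n. b k * (\<rho> x * e k x)) + (\<Sum>j<n. \<Sum>k<n. b j * b k * (e j x * e k x))" for x
    proof -
      have "(\<Sum>k<n. b k * (\<rho> x * e k x)) = \<rho> x * (\<Sum>k<n. b k * e k x)"
        by (simp add: sum_distrib_left mult_ac)
      moreover have "(\<Sum>j<n. \<Sum>k<n. b j * b k * (e j x * e k x)) = (\<Sum>k<n. b k * e k x)\<^sup>2"
        by (simp add: power2_eq_square sum_product mult_ac)
      ultimately show ?thesis by (simp add: power2_diff)
    qed
    then have "(\<integral>x. (\<rho> x - (\<Sum>k<n. b k * e k x))\<^sup>2 \<partial>\<mu>) =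
        R - 2 * (\<Sum>k<n. b k * a k) + (\<Sum>j<n. \<Sum>k<n. b j * b k * (if j = k then 1 else 0))"
      by (simp add: int_\<rho> int_\<rho>e int_ee R_def a orthonormal)
    also have "(\<Sum>j<n. \<Sum>k<n. b j * b k * (if j = k then 1 else 0)) = (\<Sum>k<n. (b k)\<^sup>2)"
      by (simp add: if_distrib power2_eq_square cong: if_cong)
    also have "R - 2 * (\<Sum>k<n. b k * a k) + (\<Sum>k<n. (b k)\<^sup>2) = R - s n + (\<Sum>k<n. (b k - a k)\<^sup>2)"
      by (simp add: s_def power2_diff sum.distrib sum_subtractf sum_distrib_left algebra_simps)
    finally show ?thesis .
  qed
  have bessel: "s n \<le> R" for n
  proof -
    have "0 \<le> (\<integral>x. (\<rho> x - (\<Sum>k<n. a k * e k x))\<^sup>2 \<partial>\<mu>)"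
      by simp
    then show ?thesis unfolding expand by simp
  qed
  have "s \<longlonglongrightarrow> R"
  proof (rule LIMSEQ_I)
    fix \<epsilon> :: real assume "\<epsilon> > 0"
    then obtain n c where c: "(\<integral>x. (cmod (\<phi> x - (\<Sum>k<n. c k * of_real (e k x))))\<^sup>2 \<partial>\<mu>) < \<epsilon>"
      using basis_dense[OF assms] by blast
    have L2: "in_L2 \<mu> (\<lambda>x. \<phi> x - (\<Sum>k<n. c k * of_real (e k x)))"
      by (intro in_L2_diff in_L2_sum in_L2_cmult in_L2_basis assms)
    \<comment> \<open>The optimal coefficients do at least as well as the real parts of the
      approximating ones.\<close>
    have "R - s n \<le> (\<integral>x. (\<rho> x - (\<Sum>k<n. Re (c k) * e k x))\<^sup>2 \<partial>\<mu>)"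
      unfolding expand by (simp add: sum_nonneg)
    also have "\<dots> = (\<integral>x. (Re (\<phi> x - (\<Sum>k<n. c k * of_real (e k x))))\<^sup>2 \<partial>\<mu>)"
      by (simp add: \<rho>_def Re_sum)
    also have "\<dots> \<le> (\<integral>x. (cmod (\<phi> x - (\<Sum>k<n. c k * of_real (e k x))))\<^sup>2 \<partial>\<mu>)"
    proof (rule integral_mono)
      show "integrable \<mu> (\<lambda>x. (Re (\<phi> x - (\<Sum>k<n. c k * of_real (e k x))))\<^sup>2)"
        using in_L2_integrable_power2[OF in_L2_of_real_Re[OF L2]]
        unfolding norm_of_real power2_abs .
      show "(Re (\<phi> x - (\<Sum>k<n. c k * of_real (e k x))))\<^sup>2 \<le> (cmod (\<phi> x - (\<Sum>k<n. c k * of_real (e k x))))\<^sup>2" for x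
        by (simp add: cmod_power2)
    qed (rule in_L2_integrable_power2[OF L2])
    finally have n: "R - s n < \<epsilon>" using c by linarith
    have "norm (s m - R) < \<epsilon>" if "m \<ge> n" for m
    proof -
      \<comment> \<open>The partial sums increase and stay below R, so one good index settles all
        later ones.\<close>
      have "s n \<le> s m"
        unfolding s_def using that by (intro sum_mono2) auto
      then show ?thesis using n bessel[of m] by simp
    qed
    then show "\<exists>n. \<forall>m\<ge>n. norm (s m - R) < \<epsilon>" by blast
  qed
  then show ?thesis
    by (simp add: sums_def s_def[abs_def] R_def \<rho>_def a_def)
qed

text \<open>The real part of - i \<phi> is the imaginary part of \<phi>, so the version for real
  parts is applied to both functions and added.\<close>

lemma parseval:
  assumes "in_L2 \<mu> \<phi>"
  shows "(\<lambda>k. (cmod (fourier_coeff \<mu> e \<phi> k))\<^sup>2) sums (\<integral>x. (cmod (\<phi> x))\<^sup>2 \<partial>\<mu>)"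
proof -
  have i: "in_L2 \<mu> (\<lambda>x. - \<i> * \<phi> x)"
    using assms by (rule in_L2_cmult)
  have int: "integrable \<mu> (\<lambda>x. (Re (\<psi> x))\<^sup>2)" if "in_L2 \<mu> \<psi>" for \<psi>
    using in_L2_integrable_power2[OF in_L2_of_real_Re[OF that]] by simp
  have "(\<lambda>k. (Re (fourier_coeff \<mu> e \<phi> k))\<^sup>2 + (Re (fourier_coeff \<mu> e (\<lambda>x. - \<i> * \<phi> x) k))\<^sup>2) sums
      ((\<integral>x. (Re (\<phi> x))\<^sup>2 \<partial>\<mu>) + (\<integral>x. (Re (- \<i> * \<phi> x))\<^sup>2 \<partial>\<mu>))"
    by (intro sums_add parseval_Re assms i)
  moreover have "(\<integral>x. (Re (\<phi> x))\<^sup>2 \<partial>\<mu>) + (\<integral>x. (Re (- \<i> * \<phi> x))\<^sup>2 \<partial>\<mu>) = (\<integral>x. (cmod (\<phi> x))\<^sup>2 \<partial>\<mu>)"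
    by (subst Bochner_Integration.integral_add[symmetric, OF int[OF assms] int[OF i]]) (simp add: cmod_power2)
  ultimately show ?thesis
    unfolding fourier_coeff_cmult by (simp add: cmod_power2)
qed

end

section \<open>The field generated by white noise\<close>

locale white_noise_field = haar: haar_basis \<mu> e + noise: gaussian_sequence M \<xi>
  for \<mu> :: "mat3 measure" and e :: "nat \<Rightarrow> mat3 \<Rightarrow> real"
    and M :: "'w measure" and \<xi> :: "nat \<Rightarrow> 'w \<Rightarrow> real" +
  fixes f :: "mat3 \<Rightarrow> complex" and X :: "mat3 \<Rightarrow> 'w \<Rightarrow> complex"
  assumes f_L2: "in_L2 \<mu> f"
    and version: "jointly_measurable_version \<mu> M X (\<lambda>g. white_noise \<mu> M e \<xi> (translate g f))"
begin

sublocale group: pair_sigma_finite \<mu> \<mu> ..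

sublocale field: pair_sigma_finite \<mu> M ..

text \<open>Parseval's identity makes the coefficients square summable, so the choice in
  \<open>white_noise\<close> has a witness.\<close>

lemma noise_limit_white_noise:
  assumes "in_L2 \<mu> \<phi>"
  shows "noise_limit M \<xi> (fourier_coeff \<mu> e \<phi>) (white_noise \<mu> M e \<xi> \<phi>)"
proof -
  obtain Z where "noise_limit M \<xi> (fourier_coeff \<mu> e \<phi>) Z"
    using noise.noise_limit_exists[OF sums_summable[OF haar.parseval[OF assms]]] .
  then show ?thesis
    unfolding white_noise_eq_noise_limit by (metis someI)
qed

lemma X_joint_measurable [measurable]: "(\<lambda>p. X (fst p) (snd p)) \<in> borel_measurable (\<mu> \<Otimes>\<^sub>M M)"
  using version by (simp add: jointly_measurable_version_def case_prod_beta')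

lemma X_measurable_noise [measurable]: "g \<in> SO3 \<Longrightarrow> X g \<in> borel_measurable M"
  using measurable_compose[OF measurable_Pair1' X_joint_measurable, of g] by (simp add: haar.space_haar)

lemma noise_limit_X:
  assumes "g \<in> SO3"
  shows "noise_limit M \<xi> (fourier_coeff \<mu> e (translate g f)) (X g)"
  using noise.noise_limit_cong_AE[OF noise_limit_white_noise[OF haar.in_L2_translate[OF f_L2 assms]]]
    version assms X_measurable_noise[OF assms] by (simp add: jointly_measurable_version_def)

lemma kernel_measurable: "(\<lambda>p. f (matrix_inv (fst p) ** snd p)) \<in> borel_measurable (\<mu> \<Otimes>\<^sub>M \<mu>)"
  by (intro measurable_compose[OF _ in_L2_measurable[OF f_L2]] haar.measurable_mult haar.measurable_inv
      measurable_fst measurable_snd)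

lemma L2_norm_translate:
  assumes "g \<in> SO3"
  shows "(\<integral>x. (cmod (translate g f x))\<^sup>2 \<partial>\<mu>) = (\<integral>x. (cmod (f x))\<^sup>2 \<partial>\<mu>)"
  unfolding translate_def
  using haar.integral_left[OF SO3_matrix_inv_closed[OF assms], of "\<lambda>x. (cmod (f x))\<^sup>2"]
    in_L2_measurable[OF f_L2] by simp

text \<open>By left invariance every slice in the second variable has the norm of f, and a constant
  is integrable over a probability measure.\<close>

lemma kernel_L2: "in_L2 (\<mu> \<Otimes>\<^sub>M \<mu>) (\<lambda>p. f (matrix_inv (fst p) ** snd p))"
proof (rule group.in_L2_pairI[OF kernel_measurable])
  show "in_L2 \<mu> (\<lambda>x. f (matrix_inv (fst (g, x)) ** snd (g, x)))" if "g \<in> space \<mu>" for g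
    using haar.in_L2_translate[OF f_L2, of g] that by (simp add: haar.space_haar translate_def)
  have "integrable \<mu> (\<lambda>_. \<integral>x. (cmod (f x))\<^sup>2 \<partial>\<mu>)"
    by simp
  then show "integrable \<mu> (\<lambda>g. \<integral>x. (cmod (f (matrix_inv (fst (g, x)) ** snd (g, x))))\<^sup>2 \<partial>\<mu>)"
    by (rule Bochner_Integration.integrable_cong[THEN iffD1, rotated -1])
      (use L2_norm_translate in \<open>simp_all add: haar.space_haar translate_def\<close>)
qed

section \<open>Expansion of the field and its remainders on the product space\<close>

definition coefficient :: "nat \<Rightarrow> mat3 \<Rightarrow> complex" where
  "coefficient k g = fourier_coeff \<mu> e (translate g f) k"

lemma coefficient_measurable [measurable]: "coefficient k \<in> borel_measurable \<mu>"
proof -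
  note [measurable] = kernel_measurable in_L2_measurable[OF haar.in_L2_basis]
  have "(\<lambda>g. \<integral>x. (\<lambda>p. f (matrix_inv (fst p) ** snd p)) (g, x) * of_real (e k x) \<partial>\<mu>) \<in> borel_measurable \<mu>"
    by measurable
  then show ?thesis
    by (simp add: coefficient_def[abs_def] fourier_coeff_def translate_def)
qed

text \<open>The total does not depend on g, because translation preserves the norm of f. The uniform
  bounds on \<open>coefficient\<close> and \<open>remainder\<close> rest on this.\<close>

lemma coefficient_sums:
  "g \<in> SO3 \<Longrightarrow> (\<lambda>k. (cmod (coefficient k g))\<^sup>2) sums (\<integral>x. (cmod (f x))\<^sup>2 \<partial>\<mu>)"
  using haar.parseval[OF haar.in_L2_translate[OF f_L2]] by (simp add: coefficient_def L2_norm_translate)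

lemma coefficient_L2: "in_L2 \<mu> (coefficient k)"
proof (rule in_L2_bounded_by[of _ _ "\<lambda>_. \<integral>x. (cmod (f x))\<^sup>2 \<partial>\<mu>"])
  show "AE g in \<mu>. (cmod (coefficient k g))\<^sup>2 \<le> (\<integral>x. (cmod (f x))\<^sup>2 \<partial>\<mu>)"
  proof (rule AE_I2)
    fix g assume "g \<in> space \<mu>"
    then have "(\<lambda>k. (cmod (coefficient k g))\<^sup>2) sums (\<integral>x. (cmod (f x))\<^sup>2 \<partial>\<mu>)"
      by (intro coefficient_sums) (simp add: haar.space_haar)
    then show "(cmod (coefficient k g))\<^sup>2 \<le> (\<integral>x. (cmod (f x))\<^sup>2 \<partial>\<mu>)"
      using sum_le_suminf[of "\<lambda>k. (cmod (coefficient k g))\<^sup>2" "{k}"] by (simp add: sums_iff)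
  qed
qed simp_all

text \<open>The case n = 0 is the field itself, so the measurability and integrability results for
  remainders include those for X.\<close>

definition remainder :: "nat \<Rightarrow> mat3 \<times> 'w \<Rightarrow> complex" where
  "remainder n p = X (fst p) (snd p) - partial_noise \<xi> (\<lambda>k. coefficient k (fst p)) n (snd p)"

lemma remainder_0: "remainder 0 p = X (fst p) (snd p)"
  by (simp add: remainder_def partial_noise_def)

lemma remainder_measurable [measurable]: "remainder n \<in> borel_measurable (\<mu> \<Otimes>\<^sub>M M)"
  unfolding remainder_def[abs_def] partial_noise_def by measurable

lemma noise_limit_X_coefficient: "g \<in> SO3 \<Longrightarrow> noise_limit M \<xi> (\<lambda>k. coefficient k g) (X g)"
  using noise_limit_X by (simp add: coefficient_def)

lemma remainder_slice_L2: "g \<in> SO3 \<Longrightarrow> in_L2 M (\<lambda>\<omega>. remainder n (g, \<omega>))"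
  unfolding remainder_def using noise_limit_X_coefficient[of g]
  by (auto simp: noise_limit_def intro!: in_L2_diff noise.in_L2_partial_noise)

lemma remainder_slice_le:
  assumes "g \<in> SO3"
  shows "(\<integral>\<omega>. (cmod (remainder n (g, \<omega>)))\<^sup>2 \<partial>M) \<le> 2 * (\<integral>x. (cmod (f x))\<^sup>2 \<partial>\<mu>)"
proof -
  have "(\<integral>\<omega>. (cmod (remainder n (g, \<omega>)))\<^sup>2 \<partial>M) \<le>
      2 * ((\<Sum>k. (cmod (coefficient k g))\<^sup>2) - (\<Sum>k<n. (cmod (coefficient k g))\<^sup>2))"
    unfolding remainder_def fst_conv snd_conv
    by (intro noise.noise_limit_dist_le noise_limit_X_coefficient assms sums_summable[OF coefficient_sums])
  also have "\<dots> \<le> 2 * (\<Sum>k. (cmod (coefficient k g))\<^sup>2)"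
    by (simp add: sum_nonneg)
  also have "(\<Sum>k. (cmod (coefficient k g))\<^sup>2) = (\<integral>x. (cmod (f x))\<^sup>2 \<partial>\<mu>)"
    using coefficient_sums[OF assms] by (simp add: sums_iff)
  finally show ?thesis .
qed

lemma remainder_slice_measurable: "(\<lambda>g. \<integral>\<omega>. (cmod (remainder n (g, \<omega>)))\<^sup>2 \<partial>M) \<in> borel_measurable \<mu>"
  by measurable

lemma remainder_L2: "in_L2 (\<mu> \<Otimes>\<^sub>M M) (remainder n)"
proof (rule field.in_L2_pairI[OF remainder_measurable])
  show "in_L2 M (\<lambda>\<omega>. remainder n (g, \<omega>))" if "g \<in> space \<mu>" for g
    using remainder_slice_L2 that by (simp add: haar.space_haar)
  show "integrable \<mu> (\<lambda>g. \<integral>\<omega>. (cmod (remainder n (g, \<omega>)))\<^sup>2 \<partial>M)"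
    using remainder_slice_measurable remainder_slice_le
    by (intro haar.integrable_const_bound[of _ "2 * (\<integral>x. (cmod (f x))\<^sup>2 \<partial>\<mu>)"])
      (auto simp: haar.space_haar)
qed

text \<open>For each g the slice integral tends to 0 by definition of the noise limit; the bound by
  twice the squared norm of f, uniform in g and n, permits dominated convergence over the
  group.\<close>

lemma remainder_tendsto_0: "(\<lambda>n. \<integral>p. (cmod (remainder n p))\<^sup>2 \<partial>(\<mu> \<Otimes>\<^sub>M M)) \<longlonglongrightarrow> 0"
proof -
  let ?D = "\<lambda>n g. \<integral>\<omega>. (cmod (remainder n (g, \<omega>)))\<^sup>2 \<partial>M"
  have "(\<lambda>n. \<integral>g. ?D n g \<partial>\<mu>) \<longlonglongrightarrow> (\<integral>g. 0 \<partial>\<mu>)"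
  proof (rule integral_dominated_convergence)
    show "integrable \<mu> (\<lambda>_. 2 * (\<integral>x. (cmod (f x))\<^sup>2 \<partial>\<mu>))"
      by simp
    show "AE g in \<mu>. (\<lambda>n. ?D n g) \<longlonglongrightarrow> 0"
      using noise_limit_X_coefficient by (intro AE_I2) (simp add: noise_limit_def remainder_def haar.space_haar)
    show "AE g in \<mu>. norm (?D n g) \<le> 2 * (\<integral>x. (cmod (f x))\<^sup>2 \<partial>\<mu>)" for n
      using remainder_slice_le by (intro AE_I2) (simp add: haar.space_haar)
  qed (simp_all add: remainder_slice_measurable)
  moreover have "(\<integral>g. ?D n g \<partial>\<mu>) = (\<integral>p. (cmod (remainder n p))\<^sup>2 \<partial>(\<mu> \<Otimes>\<^sub>M M))" for n
    using field.integral_fst'[OF in_L2_integrable_power2[OF remainder_L2[of n]]] by simp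
  ultimately show ?thesis by simp
qed

lemma X_slice_L2: "AE \<omega> in M. in_L2 \<mu> (\<lambda>g. X g \<omega>)"
  using field.in_L2_AE_slice[OF remainder_L2[of 0]] by (simp add: remainder_0)

text \<open>Smearing the field with \<open>\<psi>\<close> amounts to evaluating the white noise at \<open>kernel \<psi>\<close>.\<close>

definition kernel :: "(mat3 \<Rightarrow> complex) \<Rightarrow> mat3 \<Rightarrow> complex" where
  "kernel \<psi> x = (\<integral>u. f (matrix_inv u ** x) * \<psi> u \<partial>\<mu>)"

lemma in_L2_kernel: "in_L2 \<mu> \<psi> \<Longrightarrow> in_L2 \<mu> (kernel \<psi>)"
  using group.in_L2_smear[OF kernel_L2, of \<psi>] by (simp add: kernel_def[abs_def])

text \<open>Fubini's theorem in u and x; the integrand is the L2 kernel times a square integrable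
  tensor product, hence integrable.\<close>

lemma fourier_coeff_kernel:
  assumes "in_L2 \<mu> \<psi>"
  shows "fourier_coeff \<mu> e (kernel \<psi>) k = (\<integral>g. coefficient k g * \<psi> g \<partial>\<mu>)"
proof -
  have "integrable (\<mu> \<Otimes>\<^sub>M \<mu>) (\<lambda>p. f (matrix_inv (fst p) ** snd p) * (\<psi> (fst p) * of_real (e k (snd p))))"
    by (intro in_L2_integrable_mult kernel_L2 group.in_L2_tensor assms haar.in_L2_basis)
  then have int: "integrable (\<mu> \<Otimes>\<^sub>M \<mu>) (\<lambda>(u, x). f (matrix_inv u ** x) * (\<psi> u * of_real (e k x)))"
    by (simp add: case_prod_beta')
  have "fourier_coeff \<mu> e (kernel \<psi>) k = (\<integral>x. (\<integral>u. f (matrix_inv u ** x) * (\<psi> u * of_real (e k x)) \<partial>\<mu>) \<partial>\<mu>)"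
    by (simp add: fourier_coeff_def kernel_def flip: mult.assoc)
  also have "\<dots> = (\<integral>u. (\<integral>x. f (matrix_inv u ** x) * (\<psi> u * of_real (e k x)) \<partial>\<mu>) \<partial>\<mu>)"
    by (rule group.Fubini_integral[OF int])
  also have "\<dots> = (\<integral>g. coefficient k g * \<psi> g \<partial>\<mu>)"
    unfolding mult.commute[of "\<psi> _"] by (simp add: coefficient_def fourier_coeff_def translate_def flip: mult.assoc)
  finally show ?thesis .
qed

text \<open>The smeared remainder is the error of the partial sums of the smeared field, so the L2
  bound for smearing and the decay of the remainders on the product space give the limit.\<close>

lemma noise_limit_smear:
  assumes \<psi>: "in_L2 \<mu> \<psi>"
  shows "noise_limit M \<xi> (fourier_coeff \<mu> e (kernel \<psi>)) (\<lambda>\<omega>. \<integral>g. X g \<omega> * \<psi> g \<partial>\<mu>)"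
proof -
  let ?Z = "\<lambda>\<omega>. \<integral>g. X g \<omega> * \<psi> g \<partial>\<mu>"
  let ?c = "fourier_coeff \<mu> e (kernel \<psi>)"
  let ?d = "\<lambda>n. \<integral>\<omega>. (cmod (?Z \<omega> - partial_noise \<xi> ?c n \<omega>))\<^sup>2 \<partial>M"
  have Z: "in_L2 M ?Z"
    using field.in_L2_smear[OF remainder_L2[of 0] \<psi>] by (simp add: remainder_0)
  \<comment> \<open>The integral may be split where the path of X is square integrable, which holds
    for almost every \<omega>.\<close>
  have eq: "AE \<omega> in M. ?Z \<omega> - partial_noise \<xi> ?c n \<omega> = (\<integral>g. remainder n (g, \<omega>) * \<psi> g \<partial>\<mu>)" for n
    using X_slice_L2
  proof eventually_elim
    case (elim \<omega>)
    have comm: "coefficient k g * of_real (\<xi> k \<omega>) * \<psi> g = coefficient k g * \<psi> g * of_real (\<xi> k \<omega>)" for k g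
      by simp
    have int: "integrable \<mu> (\<lambda>g. coefficient k g * of_real (\<xi> k \<omega>) * \<psi> g)" for k
      unfolding comm by (intro integrable_mult_left in_L2_integrable_mult coefficient_L2 \<psi>)
    have "(\<integral>g. remainder n (g, \<omega>) * \<psi> g \<partial>\<mu>) =
        (\<integral>g. X g \<omega> * \<psi> g - (\<Sum>k<n. coefficient k g * of_real (\<xi> k \<omega>) * \<psi> g) \<partial>\<mu>)"
      by (simp add: remainder_def partial_noise_def left_diff_distrib sum_distrib_right)
    also have "\<dots> = ?Z \<omega> - (\<Sum>k<n. \<integral>g. coefficient k g * of_real (\<xi> k \<omega>) * \<psi> g \<partial>\<mu>)"
      using in_L2_integrable_mult[OF elim \<psi>] int by simp
    also have "\<dots> = ?Z \<omega> - partial_noise \<xi> ?c n \<omega>"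
      unfolding partial_noise_def fourier_coeff_kernel[OF \<psi>] comm by simp
    finally show ?case by (rule sym)
  qed
  have le: "?d n \<le> (\<integral>p. (cmod (remainder n p))\<^sup>2 \<partial>(\<mu> \<Otimes>\<^sub>M M)) * (\<integral>g. (cmod (\<psi> g))\<^sup>2 \<partial>\<mu>)" for n
  proof -
    note [measurable] = in_L2_measurable[OF Z] in_L2_measurable[OF field.in_L2_smear[OF remainder_L2[of n] \<psi>]]
    have "?d n = (\<integral>\<omega>. (cmod (\<integral>g. remainder n (g, \<omega>) * \<psi> g \<partial>\<mu>))\<^sup>2 \<partial>M)"
      by (rule integral_cong_AE) (use eq[of n] in auto)
    also have "\<dots> \<le> (\<integral>p. (cmod (remainder n p))\<^sup>2 \<partial>(\<mu> \<Otimes>\<^sub>M M)) * (\<integral>g. (cmod (\<psi> g))\<^sup>2 \<partial>\<mu>)"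
      by (rule field.L2_smear_le[OF remainder_L2 \<psi>])
    finally show ?thesis .
  qed
  have lim: "(\<lambda>n. (\<integral>p. (cmod (remainder n p))\<^sup>2 \<partial>(\<mu> \<Otimes>\<^sub>M M)) * (\<integral>g. (cmod (\<psi> g))\<^sup>2 \<partial>\<mu>)) \<longlonglongrightarrow> 0"
    by (rule tendsto_mult_left_zero[OF remainder_tendsto_0])
  have "?d \<longlonglongrightarrow> 0"
  proof (rule Lim_null_comparison[OF eventuallyI lim])
    show "norm (?d n) \<le> (\<integral>p. (cmod (remainder n p))\<^sup>2 \<partial>(\<mu> \<Otimes>\<^sub>M M)) * (\<integral>g. (cmod (\<psi> g))\<^sup>2 \<partial>\<mu>)" for n
      unfolding real_norm_def by (subst abs_of_nonneg) (simp, rule le)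
  qed
  then show ?thesis using Z by (simp add: noise_limit_def)
qed

text \<open>A linear combination of noise values is the noise at the same combination of functions,
  and Parseval's identity supplies the variance of its real part. Gaussianity, isotropy and complex
  Gaussianity are all read off from this formula.\<close>

lemma char_white_noise_sum:
  assumes "\<And>i. i \<in> A \<Longrightarrow> in_L2 \<mu> (\<phi> i)"
    and "\<And>i. i \<in> A \<Longrightarrow> noise_limit M \<xi> (fourier_coeff \<mu> e (\<phi> i)) (Z i)"
  shows "(\<integral>\<omega>. iexp (Re (\<Sum>i\<in>A. w i * Z i \<omega>)) \<partial>M) =
    of_real (exp (- (\<integral>x. (Re (\<Sum>i\<in>A. w i * \<phi> i x))\<^sup>2 \<partial>\<mu>) / 2))"
proof (rule noise.char_noise_limit)
  have w: "in_L2 \<mu> (\<lambda>x. w i * \<phi> i x)" if "i \<in> A" for i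
    by (intro in_L2_cmult assms that)
  have "fourier_coeff \<mu> e (\<lambda>x. \<Sum>i\<in>A. w i * \<phi> i x) = (\<lambda>k. \<Sum>i\<in>A. w i * fourier_coeff \<mu> e (\<phi> i) k)"
    by (simp add: fun_eq_iff haar.fourier_coeff_sum[OF w] haar.fourier_coeff_cmult)
  then show "noise_limit M \<xi> (fourier_coeff \<mu> e (\<lambda>x. \<Sum>i\<in>A. w i * \<phi> i x)) (\<lambda>\<omega>. \<Sum>i\<in>A. w i * Z i \<omega>)"
    using noise.noise_limit_sum[of A "\<lambda>i k. w i * fourier_coeff \<mu> e (\<phi> i) k" "\<lambda>i \<omega>. w i * Z i \<omega>"]
      noise.noise_limit_cmult assms(2) by simp
  show "(\<lambda>k. (Re (fourier_coeff \<mu> e (\<lambda>x. \<Sum>i\<in>A. w i * \<phi> i x) k))\<^sup>2) sums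
      (\<integral>x. (Re (\<Sum>i\<in>A. w i * \<phi> i x))\<^sup>2 \<partial>\<mu>)"
    by (intro haar.parseval_Re in_L2_sum w)
qed

section \<open>The properties of the field\<close>

lemma second_order_X: "second_order M X"
  using noise_limit_X by (auto simp: second_order_def noise_limit_def)

lemma square_integrable_X: "square_integrable_field \<mu> M X"
  using X_slice_L2 by (simp add: square_integrable_field_def)

lemma gaussian_X: "gaussian_field M X"
  unfolding gaussian_field_def
proof (intro allI impI)
  fix m :: nat and g :: "nat \<Rightarrow> mat3" and a b :: "nat \<Rightarrow> real"
  assume g: "\<forall>i<m. g i \<in> SO3"
  \<comment> \<open>With w = a - i b the real combination a Re z + b Im z becomes Re (w z).\<close>
  define w where "w i = Complex (a i) (- b i)" for i
  define v where "v = (\<integral>x. (Re (\<Sum>i<m. w i * translate (g i) f x))\<^sup>2 \<partial>\<mu>)"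
  have Re_w: "(\<Sum>i<m. a i * Re (X (g i) \<omega>) + b i * Im (X (g i) \<omega>)) = Re (\<Sum>i<m. w i * X (g i) \<omega>)" for \<omega>
    by (simp add: w_def Re_sum)
  show "gaussian_rv M (\<lambda>\<omega>. \<Sum>i<m. a i * Re (X (g i) \<omega>) + b i * Im (X (g i) \<omega>))"
  proof (rule gaussian_rvI_char[where v = v])
    show "prob_space M" by (rule noise.prob_space_axioms)
    have "(\<lambda>\<omega>. a i * Re (X (g i) \<omega>) + b i * Im (X (g i) \<omega>)) \<in> borel_measurable M" if "i < m" for i
    proof -
      have [measurable]: "X (g i) \<in> borel_measurable M"
        using X_measurable_noise g that by blast
      show ?thesis by measurable
    qed
    then show "(\<lambda>\<omega>. \<Sum>i<m. a i * Re (X (g i) \<omega>) + b i * Im (X (g i) \<omega>)) \<in> borel_measurable M"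
      by (intro borel_measurable_sum) simp
    show "0 \<le> v" by (simp add: v_def)
    fix t :: real
    have scale: "t * Re (\<Sum>i<m. w i * Y i) = Re (\<Sum>i<m. (t * w i) * Y i)" for Y
    proof -
      have "(\<Sum>i<m. (t * w i) * Y i) = of_real t * (\<Sum>i<m. w i * Y i)"
        by (simp add: sum_distrib_left mult.assoc)
      then show ?thesis by simp
    qed
    have "(\<integral>\<omega>. iexp (t * Re (\<Sum>i<m. w i * X (g i) \<omega>)) \<partial>M) =
        of_real (exp (- (\<integral>x. (t * Re (\<Sum>i<m. w i * translate (g i) f x))\<^sup>2 \<partial>\<mu>) / 2))"
      unfolding scale using g
      by (intro char_white_noise_sum haar.in_L2_translate f_L2 noise_limit_X) auto
    also have "(\<integral>x. (t * Re (\<Sum>i<m. w i * translate (g i) f x))\<^sup>2 \<partial>\<mu>) = v * t\<^sup>2"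
      by (simp add: v_def power_mult_distrib mult.commute)
    finally show "(\<integral>\<omega>. iexp (t * (\<Sum>i<m. a i * Re (X (g i) \<omega>) + b i * Im (X (g i) \<omega>))) \<partial>M) =
        of_real (exp (- (v * t\<^sup>2) / 2))"
      unfolding Re_w .
  qed
qed

text \<open>Substituting g u for u cancels the translation of h and leaves u^-1 (g^-1 x) in the
  argument of f. The conjugation matches the one in \<open>smeared\<close>.\<close>

lemma kernel_translate:
  assumes h: "in_L2 \<mu> h" and g: "g \<in> SO3" and x: "x \<in> SO3"
  shows "kernel (\<lambda>u. cnj (translate g h u)) x = kernel (\<lambda>u. cnj (h u)) (matrix_inv g ** x)"
proof -
  let ?F = "\<lambda>u. f (matrix_inv u ** x) * cnj (h (matrix_inv g ** u))"
  have "(\<lambda>u. f (matrix_inv u ** x)) \<in> borel_measurable \<mu>"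
    using x by (intro measurable_compose[OF _ in_L2_measurable[OF f_L2]] haar.measurable_mult
        haar.measurable_inv haar.SO3_measurable_const) simp_all
  moreover have "(\<lambda>u. h (matrix_inv g ** u)) \<in> borel_measurable \<mu>"
    by (intro in_L2_measurable haar.in_L2_left h SO3_matrix_inv_closed g)
  ultimately have [measurable]: "?F \<in> borel_measurable \<mu>"
    by measurable
  have "kernel (\<lambda>u. cnj (translate g h u)) x = (\<integral>u. ?F u \<partial>\<mu>)"
    by (simp add: kernel_def translate_def)
  also have "\<dots> = (\<integral>u. ?F (g ** u) \<partial>\<mu>)"
    by (rule haar.integral_left[OF g, symmetric]) measurable
  also have "\<dots> = kernel (\<lambda>u. cnj (h u)) (matrix_inv g ** x)"
    unfolding kernel_def
    using g by (intro Bochner_Integration.integral_cong)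
      (simp_all add: haar.space_haar SO3_matrix_inv_mult SO3_inverse_left matrix_mul_assoc)
  finally show ?thesis .
qed

lemma smeared_measurable:
  assumes "in_L2 \<mu> h"
  shows "smeared \<mu> X h \<in> borel_measurable M"
  using noise_limit_smear[OF in_L2_cnj[OF assms]]
  by (simp add: noise_limit_def in_L2_def smeared_def[abs_def])

lemma isotropic_X: "isotropic \<mu> M X"
  unfolding isotropic_def
proof (intro ballI allI impI)
  fix g :: mat3 and m :: nat and h :: "nat \<Rightarrow> mat3 \<Rightarrow> complex"
  assume g: "g \<in> SO3" and "\<forall>i<m. in_L2 \<mu> (h i)"
  then have h: "\<And>i. i < m \<Longrightarrow> in_L2 \<mu> (h i)" by blast
  have gh: "\<And>i. i < m \<Longrightarrow> in_L2 \<mu> (translate g (h i))"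
    using haar.in_L2_translate[OF h g] .
  have fin: "finite_measure M"
    by (rule noise.finite_measure_axioms)
  let ?\<phi> = "\<lambda>i. kernel (\<lambda>u. cnj (h i u))"
  show "distr M (Pi\<^sub>M {..<m} (\<lambda>_. borel)) (\<lambda>\<omega>. \<lambda>i\<in>{..<m}. smeared \<mu> X (h i) \<omega>) =
      distr M (Pi\<^sub>M {..<m} (\<lambda>_. borel)) (\<lambda>\<omega>. \<lambda>i\<in>{..<m}. smeared \<mu> X (translate g (h i)) \<omega>)"
  proof (rule complex_char_eq_imp_distr_eq[OF fin fin])
    show "smeared \<mu> X (h i) \<in> borel_measurable M" "smeared \<mu> X (translate g (h i)) \<in> borel_measurable M"
      if "i < m" for i
      by (intro smeared_measurable h gh that)+
    fix w :: "nat \<Rightarrow> complex"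
    let ?G = "\<lambda>x. (Re (\<Sum>i<m. w i * ?\<phi> i x))\<^sup>2"
    have "(\<lambda>x. \<Sum>i<m. w i * ?\<phi> i x) \<in> borel_measurable \<mu>"
      by (intro in_L2_measurable in_L2_sum in_L2_cmult in_L2_kernel in_L2_cnj h) simp
    then have G: "?G \<in> borel_measurable \<mu>"
      by measurable
    have "(\<integral>x. (Re (\<Sum>i<m. w i * kernel (\<lambda>u. cnj (translate g (h i) u)) x))\<^sup>2 \<partial>\<mu>) = (\<integral>x. ?G (matrix_inv g ** x) \<partial>\<mu>)"
      by (intro Bochner_Integration.integral_cong) (simp_all add: haar.space_haar kernel_translate[OF h g])
    also have "\<dots> = (\<integral>x. ?G x \<partial>\<mu>)"
      by (rule haar.integral_left[OF SO3_matrix_inv_closed[OF g] G])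
    finally have variance: "(\<integral>x. (Re (\<Sum>i<m. w i * kernel (\<lambda>u. cnj (translate g (h i) u)) x))\<^sup>2 \<partial>\<mu>) = (\<integral>x. ?G x \<partial>\<mu>)" .
    have "(\<integral>\<omega>. iexp (Re (\<Sum>i<m. w i * smeared \<mu> X (h i) \<omega>)) \<partial>M) = of_real (exp (- (\<integral>x. ?G x \<partial>\<mu>) / 2))"
      unfolding smeared_def
      by (intro char_white_noise_sum in_L2_kernel noise_limit_smear in_L2_cnj h) simp_all
    also have "\<dots> = (\<integral>\<omega>. iexp (Re (\<Sum>i<m. w i * smeared \<mu> X (translate g (h i)) \<omega>)) \<partial>M)"
      unfolding smeared_def variance[symmetric]
      by (intro char_white_noise_sum[symmetric] in_L2_kernel noise_limit_smear in_L2_cnj gh) simp_all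
    finally show "(\<integral>\<omega>. iexp (Re (\<Sum>i<m. w i * smeared \<mu> X (h i) \<omega>)) \<partial>M) =
        (\<integral>\<omega>. iexp (Re (\<Sum>i<m. w i * smeared \<mu> X (translate g (h i)) \<omega>)) \<partial>M)" .
  qed
qed

text \<open>Since (g k)^-1 x = k^-1 (g^-1 x), association on the left makes the translate by g k a
  multiple of the translate by g. The coefficients are then proportional, and uniqueness of noise
  limits carries this over to the field.\<close>

lemma of_type_X:
  assumes "bi_associated s f"
  shows "of_type s M X"
  unfolding of_type_def
proof (intro ballI)
  fix g k assume g: "g \<in> SO3" and k: "k \<in> K_north"
  have k': "k \<in> SO3" using k by (rule K_north_SO3)
  let ?c = "chi s (matrix_inv k)"
  have eq: "translate (g ** k) f x = ?c * translate g f x" if "x \<in> SO3" for x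
  proof -
    \<comment> \<open>The identity matrix is inserted as the right factor to fit the two-sided form
      of \<open>bi_associated\<close>; its character is 1.\<close>
    have "translate (g ** k) f x = f (matrix_inv k ** (matrix_inv g ** x) ** mat 1)"
      using g k' by (simp add: translate_def SO3_matrix_inv_mult matrix_mul_assoc)
    also have "\<dots> = chi s (matrix_inv k) * f (matrix_inv g ** x) * chi s (mat 1)"
      using assms g k that K_north_mat_1 K_north_matrix_inv SO3_mult SO3_matrix_inv_closed
      unfolding bi_associated_def by blast
    finally show ?thesis by (simp add: translate_def chi_mat_1)
  qed
  have "fourier_coeff \<mu> e (translate (g ** k) f) n = ?c * fourier_coeff \<mu> e (translate g f) n" for n
  proof -
    have "fourier_coeff \<mu> e (translate (g ** k) f) n = fourier_coeff \<mu> e (\<lambda>x. ?c * translate g f x) n"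
      unfolding fourier_coeff_def
      by (intro Bochner_Integration.integral_cong) (simp_all add: haar.space_haar eq)
    then show ?thesis by (simp add: haar.fourier_coeff_cmult)
  qed
  then have "fourier_coeff \<mu> e (translate (g ** k) f) = (\<lambda>n. ?c * fourier_coeff \<mu> e (translate g f) n)"
    by (rule ext)
  then have "noise_limit M \<xi> (\<lambda>n. ?c * fourier_coeff \<mu> e (translate g f) n) (X (g ** k))"
    using noise_limit_X[OF SO3_mult[OF g k']] by metis
  then show "AE \<omega> in M. X (g ** k) \<omega> = ?c * X g \<omega>"
    by (rule noise.noise_limit_unique[OF _ noise.noise_limit_cmult[OF noise_limit_X[OF g]]])
qed

lemma integral_kernel_power2_eq_0:
  assumes bi: "bi_associated s f" and "s \<noteq> 0" and \<psi>: "in_L2 \<mu> \<psi>"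
  shows "(\<integral>x. (kernel \<psi> x)\<^sup>2 \<partial>\<mu>) = 0"
proof -
  obtain k where k: "k \<in> K_north" and chi: "(chi s k)\<^sup>2 = -1"
    using chi_power2_eq_minus_1[OF \<open>s \<noteq> 0\<close>] .
  have eq: "kernel \<psi> (x ** k) = chi s k * kernel \<psi> x" if x: "x \<in> SO3" for x
  proof -
    have "f (matrix_inv u ** (x ** k)) = f (matrix_inv u ** x) * chi s k" if "u \<in> SO3" for u
    proof -
      have "f (matrix_inv u ** (x ** k)) = f (mat 1 ** (matrix_inv u ** x) ** k)"
        by (simp add: matrix_mul_assoc)
      also have "\<dots> = chi s (mat 1) * f (matrix_inv u ** x) * chi s k"
        using bi k that x K_north_mat_1 SO3_mult SO3_matrix_inv_closed
        unfolding bi_associated_def by blast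
      finally show ?thesis by (simp add: chi_mat_1)
    qed
    then have "kernel \<psi> (x ** k) = (\<integral>u. chi s k * (f (matrix_inv u ** x) * \<psi> u) \<partial>\<mu>)"
      unfolding kernel_def
      by (intro Bochner_Integration.integral_cong) (simp_all add: haar.space_haar)
    then show ?thesis by (simp add: kernel_def)
  qed
  have [measurable]: "kernel \<psi> \<in> borel_measurable \<mu>"
    by (intro in_L2_measurable in_L2_kernel \<psi>)
  \<comment> \<open>Right invariance of Haar measure enters here: the integral equals its own
    negative.\<close>
  have "(\<integral>x. (kernel \<psi> x)\<^sup>2 \<partial>\<mu>) = (\<integral>x. (kernel \<psi> (x ** k))\<^sup>2 \<partial>\<mu>)"
    by (rule haar.integral_right[OF K_north_SO3[OF k], symmetric]) measurable
  also have "\<dots> = (\<integral>x. - (kernel \<psi> x)\<^sup>2 \<partial>\<mu>)"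
    by (intro Bochner_Integration.integral_cong) (simp_all add: haar.space_haar eq power_mult_distrib chi)
  finally show ?thesis by simp
qed

text \<open>Since \<open>\<integral>\<phi>\<^sup>2 = 0\<close> for \<open>\<phi> = kernel \<psi>\<close>, the variance of \<open>Re (w Z)\<close> depends on \<open>w\<close> only through \<open>|w|\<close>.\<close>

lemma char_smear:
  assumes bi: "bi_associated s f" and "s \<noteq> 0" and \<psi>: "in_L2 \<mu> \<psi>"
  shows "(\<integral>\<omega>. iexp (Re (w * (\<integral>g. X g \<omega> * \<psi> g \<partial>\<mu>))) \<partial>M) =
    of_real (exp (- ((\<integral>x. (cmod (kernel \<psi> x))\<^sup>2 \<partial>\<mu>) / 2 * (cmod w)\<^sup>2) / 2))"
proof -
  let ?\<phi> = "kernel \<psi>"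
  have L2: "in_L2 \<mu> ?\<phi>" by (rule in_L2_kernel[OF \<psi>])
  have int: "integrable \<mu> (\<lambda>x. (?\<phi> x)\<^sup>2)"
    using in_L2_integrable_mult[OF L2 L2] by (simp add: power2_eq_square)
  \<comment> \<open>From (Re u)^2 = (|u|^2 + Re (u^2)) / 2 at u = w z; after integration the second
    term vanishes.\<close>
  have "(Re (w * z))\<^sup>2 = (cmod w)\<^sup>2 / 2 * (cmod z)\<^sup>2 + Re (w\<^sup>2 / 2 * z\<^sup>2)" for z
  proof -
    have "Re (u\<^sup>2) = 2 * (Re u)\<^sup>2 - (cmod u)\<^sup>2" for u
      unfolding cmod_power2 by (simp add: power2_eq_square)
    from this[of "w * z"] have "(Re (w * z))\<^sup>2 = (cmod (w * z))\<^sup>2 / 2 + Re ((w * z)\<^sup>2) / 2"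
      by linarith
    moreover have "Re ((w * z)\<^sup>2) / 2 = Re (w\<^sup>2 / 2 * z\<^sup>2)"
      by (simp add: power_mult_distrib)
    moreover have "(cmod (w * z))\<^sup>2 / 2 = (cmod w)\<^sup>2 / 2 * (cmod z)\<^sup>2"
      by (simp add: norm_mult power_mult_distrib)
    ultimately show ?thesis by linarith
  qed
  then have "(\<integral>x. (Re (w * ?\<phi> x))\<^sup>2 \<partial>\<mu>) =
      (\<integral>x. (cmod w)\<^sup>2 / 2 * (cmod (?\<phi> x))\<^sup>2 + Re (w\<^sup>2 / 2 * (?\<phi> x)\<^sup>2) \<partial>\<mu>)"
    by simp
  also have "\<dots> = (\<integral>x. (cmod w)\<^sup>2 / 2 * (cmod (?\<phi> x))\<^sup>2 \<partial>\<mu>) + (\<integral>x. Re (w\<^sup>2 / 2 * (?\<phi> x)\<^sup>2) \<partial>\<mu>)"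
    by (intro Bochner_Integration.integral_add integrable_mult_right integrable_Re int
        in_L2_integrable_power2 L2)
  also have "(\<integral>x. Re (w\<^sup>2 / 2 * (?\<phi> x)\<^sup>2) \<partial>\<mu>) = Re (w\<^sup>2 / 2 * (\<integral>x. (?\<phi> x)\<^sup>2 \<partial>\<mu>))"
    by (subst integral_Re) (intro integrable_mult_right int, simp only: integral_mult_right_zero)
  also have "\<dots> = 0"
    using integral_kernel_power2_eq_0[OF assms] by simp
  finally have variance: "(\<integral>x. (Re (w * ?\<phi> x))\<^sup>2 \<partial>\<mu>) = (\<integral>x. (cmod (?\<phi> x))\<^sup>2 \<partial>\<mu>) / 2 * (cmod w)\<^sup>2"
    by simp
  \<comment> \<open>The formula for sums of noise values is used with a one-element index
    set.\<close>
  have singleton: "(\<Sum>i\<in>{0::nat}. z) = z" for z :: complex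
    by simp
  have "(\<integral>\<omega>. iexp (Re (\<Sum>i\<in>{0::nat}. w * (\<integral>g. X g \<omega> * \<psi> g \<partial>\<mu>))) \<partial>M) =
      of_real (exp (- (\<integral>x. (Re (\<Sum>i\<in>{0::nat}. w * ?\<phi> x))\<^sup>2 \<partial>\<mu>) / 2))"
    by (rule char_white_noise_sum[OF L2 noise_limit_smear[OF \<psi>]])
  then show ?thesis
    unfolding singleton variance .
qed

text \<open>The joint characteristic function of real and imaginary part is exp (- V (a^2 + b^2) /
  2), with V half the squared norm of the kernel. It is a product of two equal factors, each
  belonging to the centred normal law of variance V.\<close>

lemma complex_gaussian_X:
  assumes bi: "bi_associated s f" and "s \<noteq> 0"
  shows "complex_gaussian_field \<mu> M X"
  unfolding complex_gaussian_field_def Let_def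
proof (intro allI impI)
  fix \<psi> assume \<psi>: "in_L2 \<mu> \<psi>"
  define Z where "Z \<omega> = (\<integral>g. X g \<omega> * \<psi> g \<partial>\<mu>)" for \<omega>
  define V where "V = (\<integral>x. (cmod (kernel \<psi> x))\<^sup>2 \<partial>\<mu>) / 2"
  have V: "0 \<le> V" by (simp add: V_def)
  have [measurable]: "Z \<in> borel_measurable M"
    using noise_limit_smear[OF \<psi>] by (simp add: noise_limit_def in_L2_def Z_def[abs_def])
  have char: "(\<integral>\<omega>. iexp (a * Re (Z \<omega>) + b * Im (Z \<omega>)) \<partial>M) = of_real (exp (- (V * (a\<^sup>2 + b\<^sup>2)) / 2))" for a b
  proof -
    have "a * Re z + b * Im z = Re (Complex a (- b) * z)" for z
      by simp
    then show ?thesis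
      using char_smear[OF assms \<psi>, of "Complex a (- b)"] by (simp add: Z_def V_def cmod_power2)
  qed
  have char_Re: "(\<integral>\<omega>. iexp (t * Re (Z \<omega>)) \<partial>M) = of_real (exp (- (V * t\<^sup>2) / 2))"
    and char_Im: "(\<integral>\<omega>. iexp (t * Im (Z \<omega>)) \<partial>M) = of_real (exp (- (V * t\<^sup>2) / 2))" for t
    using char[of t 0] char[of 0 t] by (simp_all del: of_real_mult)
  have "gaussian_rv M (\<lambda>\<omega>. Re (Z \<omega>))" "gaussian_rv M (\<lambda>\<omega>. Im (Z \<omega>))"
    by (rule gaussian_rvI_char[OF noise.prob_space_axioms _ V]; (rule char_Re char_Im | measurable))+
  moreover have "noise.indep_var borel (\<lambda>\<omega>. Re (Z \<omega>)) borel (\<lambda>\<omega>. Im (Z \<omega>))"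
  proof (rule noise.indep_varI_char)
    show "(\<integral>\<omega>. iexp (a * Re (Z \<omega>) + b * Im (Z \<omega>)) \<partial>M) =
        (\<integral>\<omega>. iexp (a * Re (Z \<omega>)) \<partial>M) * (\<integral>\<omega>. iexp (b * Im (Z \<omega>)) \<partial>M)" for a b
      unfolding char char_Re char_Im
      by (subst of_real_mult[symmetric], subst exp_add[symmetric]) (simp add: field_simps)
  qed measurable
  moreover have "noise.variance (\<lambda>\<omega>. Re (Z \<omega>)) = noise.variance (\<lambda>\<omega>. Im (Z \<omega>))"
  proof -
    \<comment> \<open>The variances are compared through the laws, which agree because their
      characteristic functions do.\<close>
    have distr: "distr M borel (\<lambda>\<omega>. Re (Z \<omega>)) = distr M borel (\<lambda>\<omega>. Im (Z \<omega>))"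
      by (rule finite_measure_Levy_uniqueness) (simp_all add: noise.finite_measure_axioms char_Re char_Im del: of_real_mult)
    have "noise.variance Y =
        (\<integral>y. (y - (\<integral>y. y \<partial>distr M borel Y))\<^sup>2 \<partial>distr M borel Y)" if [measurable]: "Y \<in> borel_measurable M" for Y :: "'w \<Rightarrow> real"
    proof -
      have mean: "(\<integral>y. y \<partial>distr M borel Y) = noise.expectation Y"
        by (rule integral_distr[of Y M borel "\<lambda>y. y"]) measurable
      have "(\<integral>y. (y - m)\<^sup>2 \<partial>distr M borel Y) = (\<integral>\<omega>. (Y \<omega> - m)\<^sup>2 \<partial>M)" for m
        by (rule integral_distr) measurable
      from this[of "noise.expectation Y"] show ?thesis
        unfolding mean by (rule sym)
    qed
    then show ?thesis by (simp add: distr)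
  qed
  ultimately show "gaussian_rv M (\<lambda>\<omega>. Re (\<integral>g. X g \<omega> * \<psi> g \<partial>\<mu>)) \<and> gaussian_rv M (\<lambda>\<omega>. Im (\<integral>g. X g \<omega> * \<psi> g \<partial>\<mu>)) \<and>
      noise.indep_var borel (\<lambda>\<omega>. Re (\<integral>g. X g \<omega> * \<psi> g \<partial>\<mu>)) borel (\<lambda>\<omega>. Im (\<integral>g. X g \<omega> * \<psi> g \<partial>\<mu>)) \<and>
      noise.variance (\<lambda>\<omega>. Re (\<integral>g. X g \<omega> * \<psi> g \<partial>\<mu>)) = noise.variance (\<lambda>\<omega>. Im (\<integral>g. X g \<omega> * \<psi> g \<partial>\<mu>))"
    by (simp add: Z_def)
qed

end

theorem proposition9p3p1:
  fixes s :: int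
    and \<mu> :: "mat3 measure" and M :: "'w measure"
    and e :: "nat \<Rightarrow> mat3 \<Rightarrow> real" and \<xi> :: "nat \<Rightarrow> 'w \<Rightarrow> real"
    and f :: "mat3 \<Rightarrow> complex" and X :: "mat3 \<Rightarrow> 'w \<Rightarrow> complex"
  assumes "prob_space M"
    and "normalized_haar \<mu>"
    and "real_orthonormal_basis \<mu> e"
    and "iid_std_normal M \<xi>"
    and "in_L2 \<mu> f"
    and "bi_associated s f"
    and "jointly_measurable_version \<mu> M X (\<lambda>g. white_noise \<mu> M e \<xi> (translate g f))"
  shows "second_order M X \<and> square_integrable_field \<mu> M X \<and> gaussian_field M X \<and>
         isotropic \<mu> M X \<and> of_type s M X \<and>
         (s \<noteq> 0 \<longrightarrow> complex_gaussian_field \<mu> M X)"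
proof -
  interpret M: prob_space M by fact
  interpret white_noise_field \<mu> e M \<xi> f X
    by unfold_locales (use assms in auto)
  show ?thesis
    using second_order_X square_integrable_X gaussian_X isotropic_X of_type_X complex_gaussian_X assms(6)
    by blast
qed

end
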